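(* Let $V$ be a vertex operator algebra, fix $n\in\mathbb{Z}_+$, and let $u\in V$ have weight $\mathrm{wt}\,u\ge-n$ such that $V^u=\langle u\rangle^1$ satisfies the permutation property. Then $A_n^u$ is generated by the elements \[ u_{-2n}^{i_{2n}}u_{-2n+1}^{i_{2n-1}}\cdots u_{-1}^{i_1}\mathbf{1}+O_n(V)\quad\text{and}\quad u_{-1}^{j}\mathbf{1}+O_n(V), \] where $i_1,\dots,i_{2n}\in\mathbb{N}$ with $-n\le i_1\mathrm{wt}\,u\le n$, and $j\in\mathbb{Z}_+$.
   Context: $V$ has vacuum $\mathbf{1}$, modes $Y(v,x)=\sum v_kx^{-k-1}$, Virasoro operators $L(m)$, weights $\mathrm{wt}$. For homogeneous $a$: $a\circ_nb=\mathrm{Res}_x(1+x)^{\mathrm{wt}\,a+n}Y(a,x)b\,x^{-2n-2}$; $O_n(V)=\{(L(-1)+L(0))v:v\in V\}+\mathrm{span}\{a\circ_nb\}$; $A_n(V)=V/O_n(V)$ with product $a*_nb=\sum_{m=0}^n(-1)^m\binom{m+n}{n}\mathrm{Res}_x(1+x)^{\mathrm{wt}\,a+n}Y(a,x)b\,x^{-n-m-1}$. $V^u=\langle u\rangle^1$ is the span of all $u_{-k_1}\cdots u_{-k_r}\mathbf{1}$ ($k_i\in\mathbb{Z}_+$), assumed a vertex subalgebra; $F_r(w)$ is the span of $u_{-k_1}\cdots u_{-k_p}w$ with $p\le r$, $k_i\ge1$. Permutation property: for all $m\in\mathbb{Z}_+$, permutations $\sigma$, $u^{(i)},w\in V^u$,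 $k_i\in\mathbb{Z}$: $u^{(1)}_{-k_1}\cdots u^{(m)}_{-k_m}w-u^{(\sigma(1))}_{-k_{\sigma(1)}}\cdots u^{(\sigma(m))}_{-k_{\sigma(m)}}w\in F_{m-1}(w)$. $A_n^u$ is the subalgebra of $A_n(V)$ generated by $\{a+O_n(V):a\in V^u\}$. *)

theory Defs
  imports Complex_Main "HOL-Library.Multiset"
begin

text \<open>A vertex operator algebra over the complex numbers.  The underlying space
is the type 'v with scalar multiplication sm; Y a m b denotes the mode a_m b
(so that Y(a,x) b = sum over m of (a_m b) x^(-m-1)); vac is the vacuum 1, om the
conformal vector (L(m) = om_(m+1)), cc the central charge.\<close>

definition Vk :: "(complex \<Rightarrow> 'v::ab_group_add \<Rightarrow> 'v) \<Rightarrow> ('v \<Rightarrow> int \<Rightarrow> 'v \<Rightarrow> 'v) \<Rightarrow> 'v \<Rightarrow> int \<Rightarrow> 'v set"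
  where "Vk sm Y om k = {v. Y om 1 v = sm (of_int k) v}"

definition is_VOA :: "(complex \<Rightarrow> 'v::ab_group_add \<Rightarrow> 'v) \<Rightarrow> ('v \<Rightarrow> int \<Rightarrow> 'v \<Rightarrow> 'v)
    \<Rightarrow> 'v \<Rightarrow> 'v \<Rightarrow> complex \<Rightarrow> bool" where
  "is_VOA sm Y vac om cc \<longleftrightarrow>
     vector_space sm
   \<and> (\<forall>a b m c. Y (a + b) m c = Y a m c + Y b m c)
   \<and> (\<forall>s a m c. Y (sm s a) m c = sm s (Y a m c))
   \<and> (\<forall>a m b c. Y a m (b + c) = Y a m b + Y a m c)
   \<and> (\<forall>a m s b. Y a m (sm s b) = sm s (Y a m b))
   \<and> (\<forall>a b. \<exists>N. \<forall>m\<ge>N. Y a m b = 0)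
   \<and> (\<forall>m b. Y vac m b = (if m = -1 then b else 0))
   \<and> (\<forall>a m. m \<ge> 0 \<longrightarrow> Y a m vac = 0)
   \<and> (\<forall>a. Y a (-1) vac = a)
   \<and> (\<forall>a b c p q r. \<exists>N. \<forall>M\<ge>N.
        (\<Sum>i=0..M. sm ((of_int p) gchoose i) (Y (Y a (r + int i) b) (p + q - int i) c))
      = (\<Sum>i=0..M. sm ((-1)^i * ((of_int r) gchoose i))
            (Y a (p + r - int i) (Y b (q + int i) c)
             - sm ((-1) powi r) (Y b (q + r - int i) (Y a (p + int i) c)))))
   \<and> (\<forall>m n v. Y om (m + 1) (Y om (n + 1) v) - Y om (n + 1) (Y om (m + 1) v)
        = sm (of_int (m - n)) (Y om (m + n + 1) v)
          + (if m + n = 0 then sm (of_int (m^3 - m) / 12 * cc) v else 0))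
   \<and> (\<forall>a n b. Y (Y om 0 a) n b = sm (- of_int n) (Y a (n - 1) b))
   \<and> om \<in> Vk sm Y om 2
   \<and> (\<forall>k. \<exists>B. finite B \<and> Vk sm Y om k \<subseteq> module.span sm B)
   \<and> (\<exists>N. \<forall>k<N. Vk sm Y om k = {0})
   \<and> module.span sm (\<Union>k. Vk sm Y om k) = UNIV"

definition hcomp :: "(complex \<Rightarrow> 'v::ab_group_add \<Rightarrow> 'v) \<Rightarrow> ('v \<Rightarrow> int \<Rightarrow> 'v \<Rightarrow> 'v) \<Rightarrow> 'v \<Rightarrow> 'v \<Rightarrow> int \<Rightarrow> 'v"
  where "hcomp sm Y om a = (THE c. finite {k. c k \<noteq> 0} \<and> (\<forall>k. c k \<in> Vk sm Y om k)
                                 \<and> a = (\<Sum>k\<in>{k. c k \<noteq> 0}. c k))"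

definition tb :: "('v \<Rightarrow> int \<Rightarrow> 'v \<Rightarrow> 'v::zero) \<Rightarrow> 'v \<Rightarrow> 'v \<Rightarrow> nat"
  where "tb Y a b = (LEAST N::nat. \<forall>m. int N \<le> m \<longrightarrow> Y a m b = 0)"

text \<open>resx sm Y e j a b = Res_x (1+x)^e Y(a,x) b x^(-j) = sum_(i>=0) (e choose i) a_(i-j) b.\<close>
definition resx :: "(complex \<Rightarrow> 'v::ab_group_add \<Rightarrow> 'v) \<Rightarrow> ('v \<Rightarrow> int \<Rightarrow> 'v \<Rightarrow> 'v) \<Rightarrow> complex \<Rightarrow> nat \<Rightarrow> 'v \<Rightarrow> 'v \<Rightarrow> 'v"
  where "resx sm Y e j a b = (\<Sum>i=0..tb Y a b + j. sm (e gchoose i) (Y a (int i - int j) b))"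

definition circ_n :: "(complex \<Rightarrow> 'v::ab_group_add \<Rightarrow> 'v) \<Rightarrow> ('v \<Rightarrow> int \<Rightarrow> 'v \<Rightarrow> 'v) \<Rightarrow> nat \<Rightarrow> int \<Rightarrow> 'v \<Rightarrow> 'v \<Rightarrow> 'v"
  where "circ_n sm Y n w a b = resx sm Y (of_int (w + int n)) (2 * n + 2) a b"

definition star_hom :: "(complex \<Rightarrow> 'v::ab_group_add \<Rightarrow> 'v) \<Rightarrow> ('v \<Rightarrow> int \<Rightarrow> 'v \<Rightarrow> 'v) \<Rightarrow> nat \<Rightarrow> int \<Rightarrow> 'v \<Rightarrow> 'v \<Rightarrow> 'v"
  where "star_hom sm Y n w a b =
    (\<Sum>m=0..n. sm ((-1)^m * of_nat ((m + n) choose n)) (resx sm Y (of_int (w + int n)) (n + m + 1) a b))"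

definition star_n :: "(complex \<Rightarrow> 'v::ab_group_add \<Rightarrow> 'v) \<Rightarrow> ('v \<Rightarrow> int \<Rightarrow> 'v \<Rightarrow> 'v) \<Rightarrow> 'v \<Rightarrow> nat \<Rightarrow> 'v \<Rightarrow> 'v \<Rightarrow> 'v"
  where "star_n sm Y om n a b =
    (\<Sum>k\<in>{k. hcomp sm Y om a k \<noteq> 0}. star_hom sm Y n k (hcomp sm Y om a k) b)"

definition O_n :: "(complex \<Rightarrow> 'v::ab_group_add \<Rightarrow> 'v) \<Rightarrow> ('v \<Rightarrow> int \<Rightarrow> 'v \<Rightarrow> 'v) \<Rightarrow> 'v \<Rightarrow> nat \<Rightarrow> 'v set"
  where "O_n sm Y om n = module.span sm
     ({Y om 0 v + Y om 1 v | v. True} \<union> {circ_n sm Y n w a b | w a b. a \<in> Vk sm Y om w})"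

text \<open>Preimage in V of the subalgebra of A_n(V) = V/O_n(V) generated by the images of S.\<close>
definition gen_n :: "(complex \<Rightarrow> 'v::ab_group_add \<Rightarrow> 'v) \<Rightarrow> ('v \<Rightarrow> int \<Rightarrow> 'v \<Rightarrow> 'v) \<Rightarrow> 'v \<Rightarrow> nat \<Rightarrow> 'v set \<Rightarrow> 'v set"
  where "gen_n sm Y om n S = \<Inter>{W. module.subspace sm W \<and> O_n sm Y om n \<subseteq> W \<and> S \<subseteq> W
                                 \<and> (\<forall>a\<in>W. \<forall>b\<in>W. star_n sm Y om n a b \<in> W)}"

fun app :: "('v \<Rightarrow> int \<Rightarrow> 'v \<Rightarrow> 'v) \<Rightarrow> ('v \<times> int) list \<Rightarrow> 'v \<Rightarrow> 'v" where
  "app Y [] w = w"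
| "app Y ((a, m) # xs) w = Y a m (app Y xs w)"

definition Vu :: "(complex \<Rightarrow> 'v::ab_group_add \<Rightarrow> 'v) \<Rightarrow> ('v \<Rightarrow> int \<Rightarrow> 'v \<Rightarrow> 'v) \<Rightarrow> 'v \<Rightarrow> 'v \<Rightarrow> 'v set"
  where "Vu sm Y vac u = module.span sm
     {app Y (map (\<lambda>k. (u, - k)) ks) vac | ks. \<forall>k\<in>set ks. k \<ge> 1}"

definition F_r :: "(complex \<Rightarrow> 'v::ab_group_add \<Rightarrow> 'v) \<Rightarrow> ('v \<Rightarrow> int \<Rightarrow> 'v \<Rightarrow> 'v) \<Rightarrow> 'v \<Rightarrow> nat \<Rightarrow> 'v \<Rightarrow> 'v set"
  where "F_r sm Y u r w = module.span sm
     {app Y (map (\<lambda>k. (u, - k)) ks) w | ks. length ks \<le> r \<and> (\<forall>k\<in>set ks. k \<ge> 1)}"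

definition perm_prop :: "(complex \<Rightarrow> 'v::ab_group_add \<Rightarrow> 'v) \<Rightarrow> ('v \<Rightarrow> int \<Rightarrow> 'v \<Rightarrow> 'v) \<Rightarrow> 'v \<Rightarrow> 'v \<Rightarrow> bool"
  where "perm_prop sm Y vac u \<longleftrightarrow>
    (\<forall>xs ys w. length xs \<ge> 1 \<and> mset ys = mset xs \<and> (\<forall>(a, k)\<in>set xs. a \<in> Vu sm Y vac u)
        \<and> w \<in> Vu sm Y vac u
       \<longrightarrow> app Y (map (\<lambda>(a, k). (a, - k)) xs) w - app Y (map (\<lambda>(a, k). (a, - k)) ys) w
            \<in> F_r sm Y u (length xs - 1) w)"

fun mon :: "('v \<Rightarrow> int \<Rightarrow> 'v \<Rightarrow> 'v) \<Rightarrow> 'v \<Rightarrow> (nat \<Rightarrow> nat) \<Rightarrow> 'v \<Rightarrow> nat \<Rightarrow> 'v" where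
  "mon Y u i v 0 = v"
| "mon Y u i v (Suc r) = (Y u (- int (Suc r)) ^^ i (Suc r)) (mon Y u i v r)"

end

(* Let W be a subspace containing O_n(V) and the generators and closed under the product.
   The p-th filtration step F_p of V^u lies in W, by induction on p: otherwise choose a linear functional f that vanishes on W but not on F_(p+1). By the permutation property the value of
   f at u_(-e_1-1) ... u_(-e_P-1) 1, with P = p + 1, depends only on the multiset of the e_i, and nonnegative
   modes lower the filtration. For a = u_(-1)^i 1, of weight i wt u, the series
   h(x) = sum_s f(a_(-s-1) b) x^s is the restriction to the diagonal of the generating function in i
   of the variables. Membership of Res (1+x)^(wt a+n) x^(-2n-2-k) Y(a,x) b in O_n(V) makes
   (1+x)^(i wt u+n) h(x) a polynomial of degree at most 2n, and a *_n b in W kills its coefficient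
   of (1+x)^n. For i = 1 this reduces all e_j to e_j < 2n; for larger i it removes,
   by induction on the number z of factors u_(-1), all monomials with |z wt u| > n. The case z = 1,
   wt u > n, where the relation for a = u is vacuous, needs the relation for a = u_(-1)^2 1. *)
theory Submission
  imports Defs "HOL-Computational_Algebra.Polynomial_FPS"
begin

section \<open>Admissible power series\<close>

lemma pochhammer_mult_diff_squares:
  "pochhammer (1 + of_int t) n * pochhammer (1 - of_int t) n
   = (of_int (\<Prod>m=1..n. int m ^ 2 - t ^ 2) :: complex)"
  by (induction n) (auto simp: pochhammer_Suc prod.nat_ivl_Suc' power2_eq_square algebra_simps)

text \<open>The coefficient of \<open>a\<^sub>-\<^sub>1 b\<close> in \<open>a *\<^sub>n b\<close> for \<open>a\<close> of weight \<open>t\<close>. It vanishes exactly when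
  \<open>0 < |t| \<le> n\<close>, which is where the condition on \<open>i\<^sub>1 wt u\<close> comes from.\<close>

definition star_lead :: "nat \<Rightarrow> int \<Rightarrow> complex" where
  "star_lead n t = (\<Sum>m=0..n. (-1) ^ m * of_nat ((m + n) choose n) * (of_int (t + int n) gchoose (n + m)))"

lemma trinomial_revision_complex:
  "of_nat ((m + n) choose n) * ((of_int t + of_nat n :: complex) gchoose (n + m))
   = (of_int t + of_nat n gchoose n) * (of_int t gchoose m)"
  using gbinomial_trinomial_revision[of n "n + m" "of_int t + of_nat n :: complex"]
  by (simp add: binomial_gbinomial add.commute mult.commute)

text \<open>Trinomial revision pulls \<open>t + n gchoose n\<close> out of every summand; what
  remains is an alternating partial sum of the binomial coefficients of t, which has a closed
  form.\<close>

lemma star_lead_eq_gbinomial: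
  "star_lead n t = (of_int t + of_nat n gchoose n) * ((-1) ^ n * (of_int t - 1 gchoose n))"
proof -
  have "star_lead n t = (\<Sum>m\<le>n. (of_int t + of_nat n gchoose n) * ((of_int t gchoose m) * (-1) ^ m))"
    unfolding star_lead_def atLeast0AtMost
    by (intro sum.cong refl) (simp add: mult_ac trinomial_revision_complex)
  then show ?thesis by (simp add: gbinomial_sum_lower_neg flip: sum_distrib_left)
qed

lemma star_lead_eq_prod:
  "star_lead n t = of_int (\<Prod>m=1..n. int m ^ 2 - t ^ 2) / (fact n) ^ 2"
proof -
  have "(of_int t + of_nat n gchoose n) = pochhammer (1 + of_int t :: complex) n / fact n"
    by (simp add: gbinomial_pochhammer' add.commute)
  moreover have "(-1) ^ n * (of_int t - 1 gchoose n) = pochhammer (1 - of_int t :: complex) n / fact n"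
    by (simp add: gbinomial_pochhammer flip: power_add)
  ultimately show ?thesis
    unfolding star_lead_eq_gbinomial pochhammer_mult_diff_squares[symmetric] by (simp add: power2_eq_square)
qed

text \<open>For |w| \<le> n the right product contains the zero factor m = |w|, while the left one
  has none because |i w| > n. For |w| > n all factors, taken as w^2 - m^2, are positive, and scaling
  w by i enlarges the product by more than the factor i.\<close>

lemma prod_diff_squares_scaled_ne:
  fixes w :: int
  assumes "n \<ge> 1" "i \<ge> 2" "\<bar>int i * w\<bar> > int n"
  shows "(\<Prod>m=1..n. int m ^ 2 - (int i * w) ^ 2) \<noteq> int i * (\<Prod>m=1..n. int m ^ 2 - w ^ 2)"
proof (cases "\<bar>w\<bar> \<le> int n")
  case True
  have "w \<noteq> 0" using assms by auto
  then have "(\<Prod>m=1..n. int m ^ 2 - w ^ 2) = 0"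
    using True by (intro prod_zero bexI[of _ "nat \<bar>w\<bar>"]) auto
  moreover have "int m ^ 2 \<noteq> (int i * w) ^ 2" if "m \<in> {1..n}" for m
  proof
    assume "int m ^ 2 = (int i * w) ^ 2"
    then have "int m = \<bar>int i * w\<bar>" by (auto simp: power2_eq_iff)
    then show False using that assms by auto
  qed
  then have "(\<Prod>m=1..n. int m ^ 2 - (int i * w) ^ 2) \<noteq> 0" by simp
  ultimately show ?thesis by (metis mult_zero_right)
next
  case False
  have pos: "0 < w ^ 2 - int m ^ 2" if "m \<le> n" for m
    using that False abs_le_square_iff[of w "int m"] by (simp add: not_le)
  have le: "w ^ 2 - int m ^ 2 \<le> (int i * w) ^ 2 - int m ^ 2" for m
    using assms(2) by (simp add: power_mult_distrib mult_le_cancel_right1)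
  \<comment> \<open>The factor m = 1 alone already gains more than i; the later factors only have to
    be monotone in |w|. Positivity is carried along to multiply inequalities.\<close>
  have "k \<le> n \<longrightarrow> int i * (\<Prod>m=1..k. w ^ 2 - int m ^ 2) < (\<Prod>m=1..k. (int i * w) ^ 2 - int m ^ 2)
     \<and> 0 < (\<Prod>m=1..k. w ^ 2 - int m ^ 2)" if "k \<ge> 1" for k
    using that
  proof (induction k rule: dec_induct)
    case base
    show ?case
    proof
      assume "1 \<le> n"
      have "int i * (w^2 - 1) < (int i * w)^2 - 1"
      proof -
        have "int i * (w^2) \<le> int i ^ 2 * w ^ 2"
          using assms(2) by (intro mult_right_mono) (auto simp: power2_eq_square)
        then show ?thesis using assms(2) by (simp add: power_mult_distrib algebra_simps)
      qed
      then show "int i * (\<Prod>m=1..1. w ^ 2 - int m ^ 2) < (\<Prod>m=1..1. (int i * w) ^ 2 - int m ^ 2)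
         \<and> 0 < (\<Prod>m=1..1. w ^ 2 - int m ^ 2)"
        using pos[OF \<open>1 \<le> n\<close>] by simp
    qed
  next
    case (step k)
    show ?case
    proof
      assume k: "Suc k \<le> n"
      let ?A = "\<Prod>m=1..k. w ^ 2 - int m ^ 2" and ?B = "\<Prod>m=1..k. (int i * w) ^ 2 - int m ^ 2"
      have IH: "int i * ?A < ?B" "0 < ?A" using step k by auto
      have "int i * ?A * (w ^ 2 - int (Suc k) ^ 2) < ?B * (w ^ 2 - int (Suc k) ^ 2)"
        using IH pos[OF k] by (intro mult_strict_right_mono) auto
      also have "\<dots> \<le> ?B * ((int i * w) ^ 2 - int (Suc k) ^ 2)"
      proof (rule mult_left_mono[OF le])
        have "0 < int i * ?A" using IH(2) assms(2) by simp
        then show "0 \<le> ?B" using IH(1) by linarith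
      qed
      finally show "int i * (\<Prod>m=1..Suc k. w ^ 2 - int m ^ 2) < (\<Prod>m=1..Suc k. (int i * w) ^ 2 - int m ^ 2)
         \<and> 0 < (\<Prod>m=1..Suc k. w ^ 2 - int m ^ 2)"
        using IH(2) pos[OF k] by (simp add: mult_ac)
    qed
  qed
  then have *: "int i * (\<Prod>m=1..n. w ^ 2 - int m ^ 2) < (\<Prod>m=1..n. (int i * w) ^ 2 - int m ^ 2)"
    using assms by auto
  have flip: "(\<Prod>m=1..n. int m ^ 2 - z ^ 2) = (-1) ^ n * (\<Prod>m=1..n. z ^ 2 - int m ^ 2)" for z
    using prod.distrib[of "\<lambda>m. -1" "\<lambda>m. z ^ 2 - int m ^ 2" "{1..n}"] by simp
  show ?thesis using * unfolding flip by simp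
qed

lemma star_lead_scaled_ne:
  assumes "n \<ge> 1" "i \<ge> 2" "\<bar>int i * w\<bar> > int n"
  shows "star_lead n (int i * w) \<noteq> of_nat i * star_lead n w"
proof
  assume "star_lead n (int i * w) = of_nat i * star_lead n w"
  then have "(of_int (\<Prod>m=1..n. int m ^ 2 - (int i * w) ^ 2) :: complex)
     = of_int (int i * (\<Prod>m=1..n. int m ^ 2 - w ^ 2))"
    by (simp add: star_lead_eq_prod del: of_int_prod)
  then show False using prod_diff_squares_scaled_ne[OF assms] by (simp only: of_int_eq_iff) 
qed

text \<open>The constraints on \<open>G(x) = \<Sum> f(a\<^bsub>-s-1\<^esub> b) x\<^sup>s\<close>, where \<open>a\<close> has weight \<open>t\<close> and \<open>f\<close> is a functional killing
  \<open>O_n(V)\<close>, \<open>a *\<^sub>n b\<close> and the nonnegative modes \<open>a\<^sub>m b\<close>: the first conjunct comes from \<open>O_n(V)\<close>, the second from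
  \<open>a *\<^sub>n b\<close>.\<close>

definition adm :: "nat \<Rightarrow> int \<Rightarrow> complex fps \<Rightarrow> bool" where
  "adm n t G \<longleftrightarrow>
     (\<forall>j>2 * n. fps_nth (fps_binomial (of_int (t + int n)) * G) j = 0) \<and>
     (\<Sum>m=0..n. (-1) ^ m * of_nat ((m + n) choose n)
        * fps_nth (fps_binomial (of_int (t + int n)) * G) (n + m)) = 0"

section \<open>Admissible series are determined by their first 2n coefficients\<close>

lemma adm_lincomb:
  assumes "adm n t G" "adm n t H"
  shows "adm n t (fps_const a * G + fps_const b * H)"
proof -
  let ?E = "fps_binomial (of_int (t + int n)) :: complex fps"
  have nth: "fps_nth (?E * (fps_const a * G + fps_const b * H)) j = a * fps_nth (?E * G) j + b * fps_nth (?E * H) j" for j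
  proof -
    have "?E * (fps_const a * G + fps_const b * H) = fps_const a * (?E * G) + fps_const b * (?E * H)"
      by (simp add: algebra_simps)
    then show ?thesis by simp
  qed
  have "(\<Sum>m=0..n. (-1) ^ m * of_nat ((m + n) choose n) * fps_nth (?E * (fps_const a * G + fps_const b * H)) (n + m))
     = a * (\<Sum>m=0..n. (-1) ^ m * of_nat ((m + n) choose n) * fps_nth (?E * G) (n + m))
     + b * (\<Sum>m=0..n. (-1) ^ m * of_nat ((m + n) choose n) * fps_nth (?E * H) (n + m))"
    unfolding nth by (simp only: sum_distrib_left sum.distrib[symmetric]) (intro sum.cong refl, simp add: algebra_simps)
  then show ?thesis using assms unfolding adm_def by (simp add: nth del: of_int_add)
qed

lemma nth_mult_gap:
  fixes G :: "complex fps"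
  assumes gap: "\<And>s. 1 \<le> s \<Longrightarrow> s < 2 * n \<Longrightarrow> fps_nth G s = 0" and n: "n \<ge> 1"
  shows "j < 2 * n \<Longrightarrow> fps_nth (F * G) j = fps_nth F j * fps_nth G 0"
    and "fps_nth (F * G) (2 * n) = fps_nth F (2 * n) * fps_nth G 0 + fps_nth F 0 * fps_nth G (2 * n)"
proof -
  show "fps_nth (F * G) j = fps_nth F j * fps_nth G 0" if "j < 2 * n"
  proof -
    have "fps_nth (F * G) j = (\<Sum>i\<in>{0..j}. if i = j then fps_nth F j * fps_nth G 0 else 0)"
      unfolding fps_mult_nth by (intro sum.cong refl) (use that gap in auto)
    then show ?thesis by simp
  qed
  have "fps_nth (F * G) (2 * n) = (\<Sum>i\<in>{0,2*n}. fps_nth F i * fps_nth G (2 * n - i))"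
    unfolding fps_mult_nth by (rule sum.mono_neutral_right) (use gap in auto)
  then show "fps_nth (F * G) (2 * n) = fps_nth F (2 * n) * fps_nth G 0 + fps_nth F 0 * fps_nth G (2 * n)"
    using n by simp
qed

text \<open>The star sum sees the coefficients n to 2n of the product. Below 2n only the constant
  term of \<open>G\<close> contributes, and at 2n its coefficient there enters once more, with the
  last star coefficient.\<close>

lemma adm_gap:
  assumes "adm n t G" "n \<ge> 1" and gap: "\<And>s. 1 \<le> s \<Longrightarrow> s < 2 * n \<Longrightarrow> fps_nth G s = 0"
  shows "star_lead n t * fps_nth G 0 + (-1) ^ n * of_nat ((2 * n) choose n) * fps_nth G (2 * n) = 0"
proof -
  let ?E = "fps_binomial (of_int (t + int n)) :: complex fps"
  let ?c = "\<lambda>m. (-1) ^ m * of_nat ((m + n) choose n) :: complex"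
  note nth = nth_mult_gap[OF gap assms(2)]
  have "(\<Sum>m=0..n. ?c m * fps_nth (?E * G) (n + m))
    = (\<Sum>m=0..n. ?c m * (of_int (t + int n) gchoose (n + m)) * fps_nth G 0
         + (if m = n then ?c n * fps_nth G (2 * n) else 0))"
  proof (intro sum.cong refl)
    fix m assume "m \<in> {0..n}"
    then show "?c m * fps_nth (?E * G) (n + m) = ?c m * (of_int (t + int n) gchoose (n + m)) * fps_nth G 0
         + (if m = n then ?c n * fps_nth G (2 * n) else 0)"
      using nth(1)[of "n + m" ?E] nth(2)[of ?E]
      by (cases "m = n") (simp_all add: ring_distribs flip: mult_2)
  qed
  also have "\<dots> = star_lead n t * fps_nth G 0 + ?c n * fps_nth G (2 * n)"
    unfolding sum.distrib star_lead_def sum_distrib_right by simp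
  finally show ?thesis using assms(1) by (simp add: adm_def mult_2)
qed

lemma fps_binomial_ne_0: "(fps_binomial a :: complex fps) \<noteq> 0"
  by (metis fps_binomial_nth fps_zero_nth gbinomial_0(1) zero_neq_one)

text \<open>The relation of \<open>adm_gap\<close> forces the coefficient at 2n to vanish too. Then
  (1 + x)^(t + n) G has no coefficient left, and power series form an integral domain.\<close>

lemma adm_eq_0:
  assumes "adm n t G" "n \<ge> 1" and z: "\<And>s. s < 2 * n \<Longrightarrow> fps_nth G s = 0"
  shows "G = 0"
proof -
  let ?E = "fps_binomial (of_int (t + int n)) :: complex fps"
  have "fps_nth G (2 * n) = 0"
    using adm_gap[OF assms(1,2)] z assms(2) by simp
  then have "fps_nth (?E * G) (2 * n) = 0" 
    using nth_mult_gap(2)[where G=G and F="?E" and n=n] assms by simp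
  moreover have "fps_nth (?E * G) j = 0" if "j < 2 * n" for j
    using nth_mult_gap(1)[where G=G and F="?E" and n=n] assms that by simp
  moreover have "fps_nth (?E * G) j = 0" if "j > 2 * n" for j
    using assms(1) that by (simp add: adm_def)
  ultimately have "?E * G = 0" by (metis fps_ext fps_zero_nth nat_neq_iff)
  then show ?thesis using fps_binomial_ne_0 by simp
qed

lemma adm_unique:
  assumes "adm n t G" "adm n t H" "n \<ge> 1" and "\<And>s. s < 2 * n \<Longrightarrow> fps_nth G s = fps_nth H s"
  shows "G = H"
proof -
  have "adm n t (fps_const 1 * G + fps_const (-1) * H)" by (rule adm_lincomb) fact+
  then have "adm n t (G - H)" by (simp flip: fps_const_neg)
  then have "G - H = 0" by (rule adm_eq_0[OF _ assms(3)]) (simp add: assms(4))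
  then show ?thesis by simp
qed

section \<open>Series with a gap and the two-variable argument\<close>

lemma fps_of_poly_truncate_fps:
  fixes F :: "complex fps"
  assumes "\<And>j. j > d \<Longrightarrow> fps_nth F j = 0"
  shows "fps_of_poly (truncate_fps (Suc d) F) = F" "degree (truncate_fps (Suc d) F) \<le> d"
  using assms degree_truncate_fps[of "Suc d" F] by (auto simp: fps_eq_iff coeff_truncate_fps)

lemma gbinomial_of_int_ne_0:
  assumes "int k \<le> z"
  shows "(of_int z gchoose k :: complex) \<noteq> 0"
proof -
  have "(of_int z gchoose k :: complex) = of_nat (nat z choose k)"
    using assms by (simp add: binomial_gbinomial)
  then show ?thesis using assms by (auto simp: not_less le_nat_iff)
qed

text \<open>The relation of \<open>adm_gap\<close> determines the coefficient \<open>l\<close> of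
  \<open>L\<close> at 2n, so \<open>\<Lambda>\<close> is a truncated binomial series corrected by
  \<open>l\<close> at the top. Multiplied by (2n choose n), both end values become, up to sign,
  products of two binomial coefficients by trinomial revision and Pascal's rule; these are nonzero
  because w > n.\<close>

lemma adm_gap_ends:
  assumes "adm n w L" "n \<ge> 1" "w > int n" "fps_nth L 0 = 1"
    and gap: "\<And>s. 1 \<le> s \<Longrightarrow> s < 2 * n \<Longrightarrow> fps_nth L s = 0"
  defines "\<Lambda> \<equiv> truncate_fps (Suc (2 * n)) (fps_binomial (of_int (w + int n)) * L)"
  shows "coeff \<Lambda> (2 * n) \<noteq> 0" "poly \<Lambda> (-1) \<noteq> 0"
proof -
  let ?N = "of_int w + of_nat n :: complex" and ?C = "of_nat ((2 * n) choose n) :: complex"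
  have sgn: "(-1) ^ n * (-1) ^ n = (1::complex)" by (simp flip: power_add)
  have C0: "?C \<noteq> 0" by simp
  define l where "l = fps_nth L (2 * n)"
  have "star_lead n w + (-1) ^ n * ?C * l = 0"
    using adm_gap[OF assms(1,2) gap] assms(4) by (simp add: l_def)
  then have "(-1) ^ n * (star_lead n w + (-1) ^ n * ?C * l) = 0" by simp
  then have "(-1) ^ n * star_lead n w + ?C * l = 0"
    using sgn by (simp add: ring_distribs flip: mult.assoc)
  then have l: "?C * l = - (?N gchoose n) * (of_int w - 1 gchoose n)"
    using sgn by (simp add: star_lead_eq_gbinomial eq_neg_iff_add_eq_0 algebra_simps)
  have co: "coeff \<Lambda> j = (?N gchoose j) + (if j = 2 * n then l else 0)" if "j \<le> 2 * n" for j
    using that nth_mult_gap[where G=L and F="fps_binomial ?N" and n=n, OF gap assms(2)] assms(4)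
    by (auto simp: \<Lambda>_def coeff_truncate_fps l_def le_less)
  have pascal: "(a gchoose n) = (a - 1 gchoose (n - 1)) + (a - 1 gchoose n)" for a :: complex
    using assms(2) by (intro gbinomial_reduce_nat) simp
  have "?C * coeff \<Lambda> (2 * n) = ?C * (?N gchoose (n + n)) + ?C * l"
    by (simp add: co ring_distribs mult_2)
  also have "?C * (?N gchoose (n + n)) = (?N gchoose n) * (of_int w gchoose n)"
    using trinomial_revision_complex[of n n w] by (simp add: mult_2)
  also have "\<dots> + ?C * l = (?N gchoose n) * (of_int w - 1 gchoose (n - 1))"
    unfolding l using pascal[of "of_int w"] by (simp add: algebra_simps)
  also have "\<dots> \<noteq> 0"
    using gbinomial_of_int_ne_0[of n "w + int n"] gbinomial_of_int_ne_0[of "n - 1" "w - 1"] assms(2,3) by simp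
  finally show "coeff \<Lambda> (2 * n) \<noteq> 0" by auto
  have deg: "degree \<Lambda> \<le> 2 * n" using degree_truncate_fps[of "Suc (2*n)"] by (simp add: \<Lambda>_def flip: less_Suc_eq_le)
  have "poly \<Lambda> (-1) = (\<Sum>j\<le>2*n. coeff \<Lambda> j * (-1) ^ j)"
    unfolding poly_altdef using deg by (intro sum.mono_neutral_left) (auto simp: coeff_eq_0)
  also have "\<dots> = (\<Sum>j\<le>2*n. (?N gchoose j) * (-1) ^ j + (if j = 2 * n then l else 0))"
    by (intro sum.cong refl) (auto simp: co)
  also have "\<dots> = (?N - 1 gchoose (n + n)) + l"
    by (simp add: sum.distrib gbinomial_sum_lower_neg mult_2)
  finally have "?C * poly \<Lambda> (-1) = ?C * (?N - 1 gchoose (n + n)) + ?C * l" by (simp add: ring_distribs)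
  also have "?C * (?N - 1 gchoose (n + n)) = (?N - 1 gchoose n) * (of_int w - 1 gchoose n)"
    using trinomial_revision_complex[of n n "w - 1"] by (simp add: mult_2 diff_add_eq)
  also have "\<dots> + ?C * l = - (?N - 1 gchoose (n - 1)) * (of_int w - 1 gchoose n)"
    unfolding l pascal[of ?N] by (simp add: algebra_simps)
  also have "\<dots> \<noteq> 0"
    using gbinomial_of_int_ne_0[of "n - 1" "w + int n - 1"] gbinomial_of_int_ne_0[of n "w - 1"] assms(2,3) by simp
  finally show "poly \<Lambda> (-1) \<noteq> 0" by auto
qed

text \<open>After multiplication by powers of \<open>1 + x\<close> the hypotheses read \<open>(1 + x)\<^sup>n B = \<Lambda> A'\<close> with
  polynomials \<open>B, \<Lambda>, A'\<close> of degree at most \<open>2n\<close>. As \<open>\<Lambda>\<close> has degree exactly \<open>2n\<close> and does not vanish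
  at \<open>-1\<close>, \<open>A'\<close> is a multiple of \<open>(1 + x)\<^sup>n\<close>, on which the star condition reads off the factor.\<close>

lemma adm_product_eq_0:
  assumes n: "n \<ge> 1" "w > int n" and L: "adm n w L" "fps_nth L 0 = 1"
    "\<And>s. 1 \<le> s \<Longrightarrow> s < 2 * n \<Longrightarrow> fps_nth L s = 0"
    and A: "adm n w A" and LA: "adm n (2 * w) (L * A)"
  shows "A = 0"
proof -
  define E :: "complex fps" where "E = fps_binomial (of_int (w + int n))"
  define E' :: "complex fps" where "E' = fps_binomial (of_int (2 * w + int n))"
  \<comment> \<open>The exponents satisfy 2 (w + n) = (2 w + n) + n, which leaves a surplus factor
    (1 + x)^n.\<close>
  have EE: "E * E = E' * (1 + fps_X) ^ n"
    unfolding E_def E'_def fps_binomial_of_nat[symmetric] fps_binomial_add_mult[symmetric] by (simp add: algebra_simps)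
  define \<Lambda> where "\<Lambda> = truncate_fps (Suc (2 * n)) (E * L)"
  define A' where "A' = truncate_fps (Suc (2 * n)) (E * A)"
  define B where "B = truncate_fps (Suc (2 * n)) (E' * (L * A))"
  have ends: "coeff \<Lambda> (2 * n) \<noteq> 0" "poly \<Lambda> (-1) \<noteq> 0"
    using adm_gap_ends[OF L(1) n L(2,3)] by (auto simp: \<Lambda>_def E_def)
  have \<Lambda>: "fps_of_poly \<Lambda> = E * L" "degree \<Lambda> \<le> 2 * n"
    and A': "fps_of_poly A' = E * A" "degree A' \<le> 2 * n"
    and B: "fps_of_poly B = E' * (L * A)" "degree B \<le> 2 * n"
    using L(1) A LA fps_of_poly_truncate_fps[of "2*n" "E * L"] fps_of_poly_truncate_fps[of "2*n" "E * A"]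
      fps_of_poly_truncate_fps[of "2*n" "E' * (L * A)"]
    by (auto simp: adm_def E_def E'_def \<Lambda>_def A'_def B_def)
  have lin: "fps_of_poly [:1, 1 :: complex:] = 1 + fps_X"
    using fps_of_poly_linear'[of "1::complex"] by simp
  have "fps_of_poly ([:1, 1:] ^ n * B) = fps_of_poly (\<Lambda> * A')"
    unfolding fps_of_poly_mult fps_of_poly_power lin \<Lambda> A' B using EE by (simp add: mult_ac)
  then have eq: "[:1, 1:] ^ n * B = \<Lambda> * A'" by (simp only: fps_of_poly_eq_iff)
  have "A' = 0"
  proof (rule ccontr)
    assume nz: "A' \<noteq> 0"
    have "\<Lambda> \<noteq> 0" using ends by auto
    then have "B \<noteq> 0" using eq nz by auto
    have deg: "degree \<Lambda> = 2 * n" using ends(1) \<Lambda>(2) le_degree by (metis le_antisym)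
    have pdeg: "degree ([:1, 1 :: complex:] ^ n) = n" by (simp add: degree_power_eq)
    \<comment> \<open>\<open>\<Lambda>\<close> uses up the full degree 2n and \<open>B\<close> has
      degree at most 2n, so at most n is left for \<open>A'\<close>.\<close>
    have "n + degree B = 2 * n + degree A'"
      using arg_cong[OF eq, of degree] \<open>B \<noteq> 0\<close> nz \<open>\<Lambda> \<noteq> 0\<close> deg pdeg by (simp add: degree_mult_eq)
    then have dA: "degree A' \<le> n" using B(2) by linarith
    have "[:- (-1), 1:] ^ n dvd \<Lambda> * A'" using eq by (metis dvd_triv_left minus_minus)
    then have "n \<le> order (-1) (\<Lambda> * A')" using order_divides[of "-1" n "\<Lambda> * A'"] nz \<open>\<Lambda> \<noteq> 0\<close> by simp
    also have "\<dots> = order (-1) A'"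
      using nz \<open>\<Lambda> \<noteq> 0\<close> ends(2) by (simp add: order_mult order_0I)
    finally have "[:- (-1), 1:] ^ n dvd A'" unfolding order_divides by simp
    then obtain D where D: "A' = [:1, 1:] ^ n * D" by (auto elim: dvdE)
    have "D \<noteq> 0" using D nz by auto
    then have "degree A' = n + degree D" using D pdeg by (simp add: degree_mult_eq)
    then have "degree D = 0" using dA by simp
    then obtain c where c: "D = [:c:]" by (auto elim: degree_eq_zeroE)
    \<comment> \<open>Since \<open>A'\<close> is c (1 + x)^n, the star sum sees only its top
      coefficient, at m = 0.\<close>
    have Aj: "fps_nth (E * A) (n + m) = (if m = 0 then c else 0)" for m
    proof -
      have "fps_nth (E * A) (n + m) = coeff A' (n + m)" by (simp flip: A'(1))
      also have "\<dots> = c * coeff ([:1, 1:] ^ n) (n + m)" by (simp add: D c)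
      finally show ?thesis
        using pdeg by (auto simp: coeff_eq_0 coeff_linear_power)
    qed
    have "(\<Sum>m=0..n. (-1) ^ m * of_nat ((m + n) choose n) * fps_nth (E * A) (n + m)) = c"
      unfolding Aj by (simp add: sum.atLeast_Suc_atMost)
    then have "c = 0" using A by (simp add: adm_def E_def)
    then show False using \<open>D \<noteq> 0\<close> c by simp
  qed
  then have "E * A = 0" using A'(1) by simp
  then show "A = 0" using fps_binomial_ne_0 by (simp add: E_def)
qed

text \<open>Admissibility in each variable forces \<open>\<phi>(x, y) = L(x) A(y) + A(x) L(y)\<close> with \<open>L = 1 + O(x\<^bsup>2n\<^esup>)\<close>, so the
  diagonal series is \<open>2 L A\<close>.\<close>

lemma adm_two_variable:
  fixes \<phi> :: "nat \<Rightarrow> nat \<Rightarrow> complex"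
  assumes n: "n \<ge> 1" "w > int n" and sym: "\<And>s t. \<phi> s t = \<phi> t s"
    and G: "\<And>t. adm n w (Abs_fps (\<lambda>s. \<phi> s t))"
    and h: "adm n (2 * w) (Abs_fps (\<lambda>s. \<Sum>j\<le>s. \<phi> j (s - j)))"
    and van: "\<And>s t. 1 \<le> s \<Longrightarrow> s < 2 * n \<Longrightarrow> 1 \<le> t \<Longrightarrow> t < 2 * n \<Longrightarrow> \<phi> s t = 0"
    and t: "1 \<le> t" "t < 2 * n"
  shows "\<phi> 0 t = 0"
proof (rule ccontr)
  assume nz: "\<phi> 0 t \<noteq> 0"
  let ?G = "\<lambda>t. Abs_fps (\<lambda>s. \<phi> s t)"
  have comb: "adm n w (fps_const a * X + fps_const b * Z)" if "adm n w X" "adm n w Z" for a b X Z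
    using adm_lincomb[OF that] .
  have scale: "adm n w (fps_const a * X)" if "adm n w X" for a X
    using comb[OF that that, of a 0] by simp
  \<comment> \<open>Column t, normalised to constant term 1; \<open>van\<close> supplies its
    gap.\<close>
  define L where "L = fps_const (1 / \<phi> 0 t) * ?G t"
  have L: "adm n w L" "fps_nth L 0 = 1" "\<And>s. 1 \<le> s \<Longrightarrow> s < 2 * n \<Longrightarrow> fps_nth L s = 0"
    using nz t van by (auto simp: L_def intro: scale G)
  \<comment> \<open>Half of \<open>\<phi> 0 0\<close> is subtracted because the term at (0, 0)
    occurs in both L(x) A(y) and A(x) L(y).\<close>
  define A where "A = fps_const 1 * ?G 0 + fps_const (- \<phi> 0 0 / 2) * L"
  have A: "adm n w A" unfolding A_def by (intro comb G L)
  have A_nth: "fps_nth A s = \<phi> s 0 - \<phi> 0 0 / 2 * fps_nth L s" for s by (simp add: A_def)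
  \<comment> \<open>Both sides vanish in degrees 1 to 2n - 1 and agree in degree 0, which suffices
    for admissible series.\<close>
  have GL: "?G r = fps_const (\<phi> 0 r) * L" if r: "1 \<le> r" "r < 2 * n" for r
  proof (rule adm_unique[OF G scale[OF L(1)] n(1)])
    fix s assume "s < 2 * n"
    then show "fps_nth (?G r) s = fps_nth (fps_const (\<phi> 0 r) * L) s"
      using L van r by (cases "s = 0") auto
  qed
  have 1: "\<phi> s r = fps_nth L s * fps_nth A r + fps_nth A s * fps_nth L r" if "r < 2 * n" for s r
  proof (cases "r = 0")
    case True
    then show ?thesis using L(2) by (simp add: A_nth algebra_simps)
  next
    case False
    then have "fps_nth (?G r) s = \<phi> 0 r * fps_nth L s" using GL[of r] that by simp
    then show ?thesis using False that L(3)[of r] sym[of r 0] by (simp add: A_nth)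
  qed
  \<comment> \<open>By symmetry, formula \<open>1\<close> supplies the first 2n coefficients of
    every column, so the formula extends to all r.\<close>
  have 2: "?G r = fps_const (fps_nth A r) * L + fps_const (fps_nth L r) * A" for r
  proof (rule adm_unique[OF G comb[OF L(1) A] n(1)])
    fix s assume "s < 2 * n"
    then show "fps_nth (?G r) s = fps_nth (fps_const (fps_nth A r) * L + fps_const (fps_nth L r) * A) s"
      using 1[of s r] sym[of r s] by simp
  qed
  have "\<phi> s r = fps_nth L s * fps_nth A r + fps_nth A s * fps_nth L r" for s r
    using arg_cong[OF 2, of "\<lambda>f. fps_nth f s" r] by (simp add: mult.commute)
  then have "Abs_fps (\<lambda>s. \<Sum>j\<le>s. \<phi> j (s - j)) = L * A + A * L"
    by (intro fps_ext) (simp only: fps_nth_Abs_fps fps_add_nth fps_mult_nth sum.distrib atLeast0AtMost)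
  then have "adm n (2 * w) (L * A + A * L)" using h by simp
  from adm_lincomb[OF this this, of "1/2" 0]
  have "adm n (2 * w) (fps_const (1/2) * (L * A + A * L))" by simp
  also have "fps_const (1/2) * (L * A + A * L) = L * A"
    by (rule fps_ext) (simp only: mult.commute[of A L] fps_mult_left_const_nth fps_add_nth, simp)
  finally have "adm n (2 * w) (L * A)" .
  then have "A = 0" using adm_product_eq_0[OF n L A] by blast
  then have "fps_nth A t = 0" by simp
  then show False using nz L(3)[OF t] sym[of t 0] by (simp add: A_nth)
qed

section \<open>Symmetric functions on index multisets\<close>

definition weak_compositions :: "nat \<Rightarrow> nat \<Rightarrow> nat list set" where
  "weak_compositions i s = {es. length es = i \<and> sum_list es = s}"

lemma finite_weak_compositions [simp]: "finite (weak_compositions i s)"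
proof (rule finite_subset)
  show "weak_compositions i s \<subseteq> {es. set es \<subseteq> {0..s} \<and> length es = i}"
    by (auto simp: weak_compositions_def intro!: member_le_sum_list)
qed (simp add: finite_lists_length_eq)

lemma weak_compositions_0: "weak_compositions 0 s = (if s = 0 then {[]} else {})"
  by (auto simp: weak_compositions_def)

lemma sum_weak_compositions_Suc:
  "(\<Sum>es\<in>weak_compositions (Suc i) s. f es) = (\<Sum>j\<le>s. \<Sum>es\<in>weak_compositions i (s - j). f (j # es))"
proof -
  have "(\<Sum>j\<le>s. \<Sum>es\<in>weak_compositions i (s - j). f (j # es))
    = (\<Sum>(j, es)\<in>Sigma {..s} (\<lambda>j. weak_compositions i (s - j)). f (j # es))"
    by (simp add: sum.Sigma)
  also have "\<dots> = (\<Sum>es\<in>weak_compositions (Suc i) s. f es)"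
    by (rule sum.reindex_bij_witness[of _ "\<lambda>es. (hd es, tl es)" "\<lambda>(j, es). j # es"])
       (auto simp: weak_compositions_def length_Suc_conv)
  finally show ?thesis by simp
qed

lemma weak_compositions_1 [simp]: "weak_compositions (Suc 0) s = {[s]}"
  by (auto simp: weak_compositions_def length_Suc_conv)

lemma sum_weak_compositions_2:
  "(\<Sum>es\<in>weak_compositions 2 s. f es) = (\<Sum>j\<le>s. f [j, s - j])"
  by (simp add: numeral_2_eq_2 sum_weak_compositions_Suc)

text \<open>Once one part equals d the others sum to 0, so only the position of d is free.\<close>

lemma card_weak_compositions_concentrated:
  assumes "d \<ge> 1"
  shows "card {es \<in> weak_compositions i d. d \<in> set es} = i"
proof -
  have "bij_betw (\<lambda>k. (replicate i 0)[k := d]) {..<i} {es \<in> weak_compositions i d. d \<in> set es}"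
    unfolding bij_betw_def
  proof
    show "inj_on (\<lambda>k. (replicate i 0)[k := d]) {..<i}"
      using assms by (intro inj_onI) (metis length_replicate lessThan_iff nth_list_update_eq nth_list_update_neq nth_replicate not_one_le_zero)
    show "(\<lambda>k. (replicate i 0)[k := d]) ` {..<i} = {es \<in> weak_compositions i d. d \<in> set es}"
    proof (intro equalityI subsetI)
      fix es assume "es \<in> (\<lambda>k. (replicate i 0)[k := d]) ` {..<i}"
      then show "es \<in> {es \<in> weak_compositions i d. d \<in> set es}"
        by (auto simp: weak_compositions_def sum_list_update set_update_memI sum_list_replicate)
    next
      fix es assume "es \<in> {es \<in> weak_compositions i d. d \<in> set es}"
      then have es: "length es = i" "sum_list es = d" "d \<in> set es" by (auto simp: weak_compositions_def)
      then obtain k where k: "k < i" "es ! k = d" by (auto simp: in_set_conv_nth)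
      have "es ! l = 0" if "l < i" "l \<noteq> k" for l
      proof -
        have "sum_list es = (\<Sum>j<i. es ! j)" using es by (simp add: sum_list_sum_nth atLeast0LessThan)
        moreover have "(\<Sum>j\<in>{k,l}. es ! j) \<le> (\<Sum>j<i. es ! j)"
          using k that by (intro sum_mono2) auto
        ultimately show ?thesis using es k that by simp
      qed
      then have "es = (replicate i 0)[k := d]"
        using es k by (intro nth_equalityI) (auto simp: nth_list_update)
      then show "es \<in> (\<lambda>k. (replicate i 0)[k := d]) ` {..<i}" using k by auto
    qed
  qed
  from bij_betw_same_card[OF this] show ?thesis by simp
qed

lemma weak_compositions_sum_0: "weak_compositions i 0 = {replicate i 0}"
proof (intro equalityI subsetI)
  fix es assume "es \<in> weak_compositions i 0"
  then have "length es = i" "\<forall>e\<in>set es. e = 0" by (auto simp: weak_compositions_def)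
  then show "es \<in> {replicate i 0}" by (simp add: replicate_eqI)
qed (simp add: weak_compositions_def sum_list_replicate)

text \<open>This makes the number of zeros drop in every coefficient except the constant one, as the
  induction on that number requires.\<close>

lemma count_0_weak_composition:
  assumes "es \<in> weak_compositions i s" "s \<ge> 1"
  shows "count (mset es) 0 < i"
proof -
  have "sum_list es \<noteq> 0" using assms by (simp add: weak_compositions_def)
  then have "\<exists>e\<in>set es. e \<noteq> 0" by (metis sum_list_eq_0_iff)
  then obtain e N where e: "e \<noteq> 0" "mset es = add_mset e N"
    by (metis in_multiset_in_set insert_DiffM)
  have "size (mset es) = i" using assms by (simp add: weak_compositions_def)
  then have "size N < i" "count (mset es) 0 = count N 0" using e by auto
  then show ?thesis using count_le_size[of N 0] by linarith
qed

text \<open>\<open>\<Phi> {e\<^sub>1, ..., e\<^sub>P}\<close> stands for the value of a functional at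
  \<open>u\<^bsub>-e\<^sub>1-1\<^esub> ... u\<^bsub>-e\<^sub>P-1\<^esub> \<one>\<close>; indices are shifted by one, so zeros in the multiset
  count the factors \<open>u\<^sub>-\<^sub>1\<close>.\<close>

locale correlation =
  fixes \<Phi> :: "nat multiset \<Rightarrow> complex" and n P :: nat and w :: int
  assumes n: "n \<ge> 1" and w: "w \<ge> - int n"
    and adm: "\<And>i M. 1 \<le> i \<Longrightarrow> size M + i = P \<Longrightarrow>
      adm n (int i * w) (Abs_fps (\<lambda>s. \<Sum>es\<in>weak_compositions i s. \<Phi> (mset es + M)))"
    and gens: "\<And>M. size M = P \<Longrightarrow> (\<And>e. e \<in># M \<Longrightarrow> e < 2 * n) \<Longrightarrow>
      \<bar>int (count M 0) * w\<bar> \<le> int n \<or> M = replicate_mset P 0 \<Longrightarrow> \<Phi> M = 0"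
begin

section \<open>Vanishing of all values of a correlation\<close>

lemma adm_single:
  assumes "size M + 1 = P"
  shows "adm n w (Abs_fps (\<lambda>s. \<Phi> (add_mset s M)))"
  using adm[of 1 M] assms by simp

lemma adm_pair:
  assumes "size M + 2 = P"
  shows "adm n (2 * w) (Abs_fps (\<lambda>s. \<Sum>j\<le>s. \<Phi> (add_mset j (add_mset (s - j) M))))"
  using adm[of 2 M] assms by (simp add: sum_weak_compositions_2)

text \<open>With the other indices fixed, the series in one index is admissible and hence zero once
  its coefficients below 2n vanish. This removes the indices \<ge> 2n one at a time.\<close>

lemma large_parts_reduce:
  assumes "\<And>M. size M = P \<Longrightarrow> (\<And>e. e \<in># M \<Longrightarrow> e < 2 * n) \<Longrightarrow> \<Phi> M = 0"
  shows "size M = P \<Longrightarrow> \<Phi> M = 0"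
proof (induction "size (filter_mset (\<lambda>e. e \<ge> 2 * n) M)" arbitrary: M)
  case 0
  then have "set_mset (filter_mset (\<lambda>e. e \<ge> 2 * n) M) = {}" by simp
  then have "e < 2 * n" if "e \<in># M" for e using that by (auto simp: not_le)
  then show ?case using assms 0 by blast
next
  case (Suc k)
  obtain e where "e \<in># filter_mset (\<lambda>e. e \<ge> 2 * n) M"
    using size_eq_Suc_imp_elem[OF Suc(2)[symmetric]] by blast
  then have e: "e \<in># M" "e \<ge> 2 * n" by auto
  define M' where "M' = M - {#e#}"
  have M: "M = add_mset e M'" using e by (simp add: M'_def)
  have k: "size (filter_mset (\<lambda>e. e \<ge> 2 * n) M') = k" using Suc(2) M e by simp
  have "Abs_fps (\<lambda>s. \<Phi> (add_mset s M')) = 0"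
  proof (rule adm_eq_0[OF adm_single n])
    show "size M' + 1 = P" using Suc(3) M by simp
    fix s assume "s < 2 * n"
    then have "k = size (filter_mset (\<lambda>e. e \<ge> 2 * n) (add_mset s M'))" using k by simp
    moreover have "size (add_mset s M') = P" using Suc(3) unfolding M by simp
    ultimately have "\<Phi> (add_mset s M') = 0" by (rule Suc(1))
    then show "fps_nth (Abs_fps (\<lambda>s. \<Phi> (add_mset s M'))) s = 0" by simp
  qed
  then have "fps_nth (Abs_fps (\<lambda>s. \<Phi> (add_mset s M'))) e = 0" by simp
  then show ?case unfolding M by simp
qed

text \<open>For a single zero the relation of the power z = 1 is that of \<open>u\<close> itself and
  gives nothing new. A second index t is therefore varied together with the zero: values with both
  indices positive vanish by \<open>zf\<close>, and \<open>adm_two_variable\<close> settles the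
  mixed ones.\<close>

lemma reduce_zeros_one:
  assumes w: "w > int n" and zf: "\<And>M. size M = P \<Longrightarrow> (\<And>e. e \<in># M \<Longrightarrow> e < 2 * n) \<Longrightarrow> count M 0 = 0 \<Longrightarrow> \<Phi> M = 0"
    and M: "size M = P" "\<And>e. e \<in># M \<Longrightarrow> e < 2 * n" "count M 0 = 1" "M \<noteq> {#0#}"
  shows "\<Phi> M = 0"
proof -
  have "0 \<in># M" using M(3) by (metis count_eq_zero_iff zero_neq_one)
  then obtain M' where M': "M = add_mset 0 M'" by (auto dest: multi_member_split)
  then obtain t R where R: "M' = add_mset t R" using M(4) by (metis multiset_cases)
  have M_eq: "M = add_mset 0 (add_mset t R)" using M' R by simp
  have nz: "t \<noteq> 0" "count R 0 = 0" using M(3) M_eq by (auto split: if_splits)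
  have P: "size R + 2 = P" using M(1) M_eq by simp
  have "(\<lambda>s t. \<Phi> (add_mset s (add_mset t R))) 0 t = 0"
  proof (rule adm_two_variable[OF n w])
    show "\<Phi> (add_mset s (add_mset r R)) = \<Phi> (add_mset r (add_mset s R))" for s r
      by (simp add: add_mset_commute)
    show "adm n w (Abs_fps (\<lambda>s. \<Phi> (add_mset s (add_mset r R))))" for r
      using adm_single[of "add_mset r R"] P by simp
    show "adm n (2 * w) (Abs_fps (\<lambda>s. \<Sum>j\<le>s. \<Phi> (add_mset j (add_mset (s - j) R))))"
      by (rule adm_pair[OF P])
    show "\<Phi> (add_mset s (add_mset r R)) = 0" if "1 \<le> s" "s < 2 * n" "1 \<le> r" "r < 2 * n" for s r
      by (rule zf) (use that P nz M(2) M_eq in auto)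
    show "1 \<le> t" "t < 2 * n" using nz M(2)[of t] M_eq by auto
  qed
  then show ?thesis by (simp add: M_eq)
qed

text \<open>The star relations for \<open>u\<^sub>-\<^sub>1\<^sup>z \<one>\<close> and for \<open>u\<close> give two equations for \<open>\<Phi> M\<close> and the value \<open>v\<close>
  obtained from \<open>M\<close> by replacing one zero by \<open>2n\<close>; their determinant is nonzero.\<close>

lemma reduce_zeros_many:
  assumes z: "count M 0 = z" "z \<ge> 2" "\<bar>int z * w\<bar> > int n"
    and IH: "\<And>M. size M = P \<Longrightarrow> (\<And>e. e \<in># M \<Longrightarrow> e < 2 * n) \<Longrightarrow> count M 0 < z \<Longrightarrow> \<Phi> M = 0"
    and M: "size M = P" "\<And>e. e \<in># M \<Longrightarrow> e < 2 * n"
  shows "\<Phi> M = 0"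
proof -
  define R where "R = M - replicate_mset z 0"
  have "replicate_mset z 0 \<subseteq># M" using z(1) by (simp add: count_le_replicate_mset_subset_eq[symmetric])
  then have M_eq: "M = replicate_mset z 0 + R" by (simp add: R_def)
  have R: "count R 0 = 0" "\<And>e. e \<in># R \<Longrightarrow> e < 2 * n" "size R + z = P"
    using z(1) M M_eq by auto
  define M1 where "M1 = replicate_mset (z - 1) 0 + R"
  have M1: "M = add_mset 0 M1" "size M1 + 1 = P" "count M1 0 = z - 1" "\<And>e. e \<in># M1 \<Longrightarrow> e < 2 * n"
  proof -
    have "replicate_mset z 0 = add_mset 0 (replicate_mset (z - 1) (0::nat))"
      using z(2) by (cases z) auto
    then show *: "M = add_mset 0 M1" by (simp add: M_eq M1_def)
    then show "size M1 + 1 = P" "count M1 0 = z - 1" "\<And>e. e \<in># M1 \<Longrightarrow> e < 2 * n"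
      using M z(1) by auto
  qed
  define v where "v = \<Phi> (add_mset (2 * n) M1)"
  let ?H = "Abs_fps (\<lambda>s. \<Sum>es\<in>weak_compositions z s. \<Phi> (mset es + R))"
  have small: "\<Phi> (mset es + R) = 0" if "es \<in> weak_compositions z s" "1 \<le> s" "\<And>e. e \<in> set es \<Longrightarrow> e < 2 * n" for es s
  proof (rule IH)
    show "size (mset es + R) = P" using that R by (simp add: weak_compositions_def)
    show "e < 2 * n" if "e \<in># mset es + R" for e using that R \<open>\<And>e. e \<in> set es \<Longrightarrow> e < 2 * n\<close> by auto
    show "count (mset es + R) 0 < z" using count_0_weak_composition[OF that(1,2)] R(1) by simp
  qed
  have le: "e \<le> s" if "es \<in> weak_compositions i s" "e \<in> set es" for e es s i
    using that member_le_sum_list[of e es] by (auto simp: weak_compositions_def)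
  \<comment> \<open>A composition of 2n either has 2n as its only nonzero part, which gives
    \<open>v\<close>, or has all parts below 2n, where the induction hypothesis applies.\<close>
  have top: "\<Phi> (mset es + R) = (if 2 * n \<in> set es then v else 0)" if "es \<in> weak_compositions z (2 * n)" for es
  proof (cases "2 * n \<in> set es")
    case False
    then have "e < 2 * n" if "e \<in> set es" for e
      using le[OF \<open>es \<in> _\<close> that] that by (metis le_neq_implies_less)
    then show ?thesis using small[OF that] n False by simp
  next
    case True
    then obtain N where N: "mset es = add_mset (2 * n) N" by (metis in_multiset_in_set insert_DiffM)
    have "sum_mset N = 0" "size N = z - 1"
      using that arg_cong[OF N, of sum_mset] arg_cong[OF N, of size] by (auto simp: weak_compositions_def sum_mset_sum_list)
    then have "N = replicate_mset (z - 1) 0"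
      by (metis sum_mset_0_iff set_mset_subset_singletonD singletonI subsetI)
    then show ?thesis using True N by (simp add: v_def M1_def)
  qed
  have 1: "star_lead n (int z * w) * \<Phi> M + (-1) ^ n * of_nat ((2 * n) choose n) * (of_nat z * v) = 0"
  proof -
    have "(\<Sum>es\<in>weak_compositions z (2 * n). \<Phi> (mset es + R))
        = (\<Sum>es\<in>weak_compositions z (2 * n). if 2 * n \<in> set es then v else 0)"
      by (intro sum.cong refl top)
    also have "\<dots> = of_nat z * v"
      using card_weak_compositions_concentrated[of "2 * n" z] n by (simp add: sum.If_cases Int_def)
    finally have "fps_nth ?H (2 * n) = of_nat z * v" by simp
    moreover have "fps_nth ?H 0 = \<Phi> M" by (simp add: weak_compositions_sum_0 M_eq)
    moreover have "fps_nth ?H s = 0" if "1 \<le> s" "s < 2 * n" for s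
      unfolding fps_nth_Abs_fps using that le by (intro sum.neutral ballI small) fastforce+
    ultimately show ?thesis
      using adm_gap[of n "int z * w" ?H] adm[of z R] n R(3) z(2) by simp
  qed
  have 2: "star_lead n w * \<Phi> M + (-1) ^ n * of_nat ((2 * n) choose n) * v = 0"
  proof -
    have "\<Phi> (add_mset s M1) = 0" if "1 \<le> s" "s < 2 * n" for s
      by (rule IH) (use that M1 z(2) in auto)
    then show ?thesis
      using adm_gap[OF adm_single[OF M1(2)] n] by (simp add: v_def M1(1))
  qed
  \<comment> \<open>Subtracting z times relation \<open>2\<close> from relation \<open>1\<close>
    eliminates \<open>v\<close>.\<close>
  have "(star_lead n (int z * w) - of_nat z * star_lead n w) * \<Phi> M
    = (star_lead n (int z * w) * \<Phi> M + (-1) ^ n * of_nat ((2 * n) choose n) * (of_nat z * v))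
      - of_nat z * (star_lead n w * \<Phi> M + (-1) ^ n * of_nat ((2 * n) choose n) * v)"
    by (simp add: algebra_simps)
  then have "(star_lead n (int z * w) - of_nat z * star_lead n w) * \<Phi> M = 0"
    by (simp only: 1 2, simp)
  then show ?thesis using star_lead_scaled_ne[OF n z(2,3)] by simp
qed

theorem vanishes:
  assumes "size M = P"
  shows "\<Phi> M = 0"
proof (rule large_parts_reduce[OF _ assms])
  fix M :: "nat multiset"
  assume "size M = P" "\<And>e. e \<in># M \<Longrightarrow> e < 2 * n"
  then show "\<Phi> M = 0"
  proof (induction "count M 0" arbitrary: M rule: less_induct)
    case less
    let ?z = "count M 0"
    show ?case
    proof (cases "\<bar>int ?z * w\<bar> \<le> int n \<or> M = replicate_mset P 0")
      case True
      then show ?thesis using gens less.prems by blast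
    next
      case False
      then have z: "\<bar>int ?z * w\<bar> > int n" by simp
      have "?z \<noteq> 0"
      proof
        assume 0: "?z = 0"
        show False using z unfolding 0 by simp
      qed
      then consider "?z = 1" | "?z \<ge> 2" by linarith
      then show ?thesis
      proof cases
        case 1
        show ?thesis
        proof (rule reduce_zeros_one)
          \<comment> \<open>Here |w| > n, and w \<ge> -n excludes the negative sign.\<close>
          show "w > int n" using z 1 w by auto
          show "M \<noteq> {#0#}" using False less.prems(1) by auto
        qed (use less 1 in auto)
      next
        case 2
        show ?thesis
          by (rule reduce_zeros_many[OF refl 2 z]) (use less in auto)
      qed
    qed
  qed
qed

end

section \<open>Vertex operator algebras\<close>

locale voa = vector_space sm for sm :: "complex \<Rightarrow> 'v::ab_group_add \<Rightarrow> 'v" +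
  fixes Y :: "'v \<Rightarrow> int \<Rightarrow> 'v \<Rightarrow> 'v" and vac om :: 'v and cc :: complex
  assumes voa: "is_VOA sm Y vac om cc"
begin

lemmas voa_laws = voa[unfolded is_VOA_def, THEN conjunct2]
lemmas Y_scale_left = voa_laws[THEN conjunct2, THEN conjunct1, rule_format]
lemmas Y_add_right = voa_laws[THEN conjunct2, THEN conjunct2, THEN conjunct1, rule_format]
lemmas Y_scale_right = voa_laws[THEN conjunct2, THEN conjunct2, THEN conjunct2, THEN conjunct1, rule_format]
lemmas Y_truncation = voa_laws[THEN conjunct2, THEN conjunct2, THEN conjunct2, THEN conjunct2, THEN conjunct1, rule_format]
lemmas Y_vac_left = voa_laws[THEN conjunct2, THEN conjunct2, THEN conjunct2, THEN conjunct2, THEN conjunct2, THEN conjunct1, rule_format]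
lemmas Y_vac_right = voa_laws[THEN conjunct2, THEN conjunct2, THEN conjunct2, THEN conjunct2, THEN conjunct2, THEN conjunct2, THEN conjunct1, rule_format]
lemmas Y_creation = voa_laws[THEN conjunct2, THEN conjunct2, THEN conjunct2, THEN conjunct2, THEN conjunct2, THEN conjunct2, THEN conjunct2, THEN conjunct1, rule_format]
lemmas borcherds = voa_laws[THEN conjunct2, THEN conjunct2, THEN conjunct2, THEN conjunct2, THEN conjunct2, THEN conjunct2, THEN conjunct2, THEN conjunct2, THEN conjunct1, rule_format]
lemmas Y_translation = voa_laws[THEN conjunct2, THEN conjunct2, THEN conjunct2, THEN conjunct2, THEN conjunct2, THEN conjunct2, THEN conjunct2, THEN conjunct2, THEN conjunct2, THEN conjunct2, THEN conjunct1, rule_format]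
lemmas om_weight = voa_laws[THEN conjunct2, THEN conjunct2, THEN conjunct2, THEN conjunct2, THEN conjunct2, THEN conjunct2, THEN conjunct2, THEN conjunct2, THEN conjunct2, THEN conjunct2, THEN conjunct2, THEN conjunct1, rule_format]

section \<open>Weights and iterates from the Borcherds identity\<close>

lemma Y_zero_left [simp]: "Y 0 m b = 0"
  using Y_scale_left[of 0 0 m b] by simp

lemma Y_zero_right [simp]: "Y a m 0 = 0"
  using Y_scale_right[of a m 0 0] by simp

lemma Y_diff_right: "Y a m (b - c) = Y a m b - Y a m c"
  using Y_add_right[of a m "b - c" c] by (simp add: algebra_simps)

lemma Y_sum_right: "Y a m (\<Sum>x\<in>A. f x) = (\<Sum>x\<in>A. Y a m (f x))"
  by (induction A rule: infinite_finite_induct) (auto simp: Y_add_right)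

lemma Y_span_right:
  assumes "v \<in> span S" "subspace T" "\<And>x. x \<in> S \<Longrightarrow> Y a m x \<in> T"
  shows "Y a m v \<in> T"
  using assms(1)
proof (induction rule: span_induct_alt)
  case base
  then show ?case using assms(2) by (simp add: subspace_0)
next
  case (step c x y)
  then show ?case using assms(2,3) by (simp add: Y_add_right Y_scale_right subspace_add subspace_scale)
qed

lemma vac_weight: "vac \<in> Vk sm Y om 0"
  by (simp add: Vk_def Y_vac_right)

text \<open>In the Borcherds identity for \<open>om\<close> with p = 1 and r = 0 only i = 0, 1
  survive on the left and i = 0 on the right. Translation and the weight of \<open>u\<close>
  evaluate the two left terms.\<close>

lemma L0_commutator:
  assumes "u \<in> Vk sm Y om w"
  shows "Y om 1 (Y u q c) - Y u q (Y om 1 c) = sm (of_int (w - q - 1)) (Y u q c)"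
proof -
  obtain N where N: "\<forall>M\<ge>N. (\<Sum>i=0..M. sm ((of_int 1) gchoose i) (Y (Y om (0 + int i) u) (1 + q - int i) c))
      = (\<Sum>i=0..M. sm ((-1)^i * ((of_int 0) gchoose i))
            (Y om (1 + 0 - int i) (Y u (q + int i) c)
             - sm ((-1) powi 0) (Y u (q + 0 - int i) (Y om (1 + int i) c))))"
    using borcherds[of 1 om 0 u q c] by blast
  let ?l = "\<lambda>i. sm ((of_int 1) gchoose i) (Y (Y om (0 + int i) u) (1 + q - int i) c)"
    and ?r = "\<lambda>i. sm ((-1)^i * ((of_int 0) gchoose i))
            (Y om (1 + 0 - int i) (Y u (q + int i) c)
             - sm ((-1) powi 0) (Y u (q + 0 - int i) (Y om (1 + int i) c)))"
  have one: "(1 :: complex) gchoose i = 0" if "i \<notin> {0, 1}" for i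
    using that binomial_gbinomial[of 1 i, where 'a = complex] by (auto simp: binomial_eq_0)
  \<comment> \<open>\<open>Suc N\<close> rather than \<open>N\<close>, so that the range surely
    contains i = 1.\<close>
  have "(\<Sum>i\<in>{0,1}. ?l i) = (\<Sum>i=0..Suc N. ?l i)"
    by (rule sum.mono_neutral_left) (auto simp: one)
  also have "\<dots> = (\<Sum>i=0..Suc N. ?r i)"
    by (rule N[rule_format]) simp
  also have "\<dots> = (\<Sum>i=0..Suc N. if i = 0 then Y om 1 (Y u q c) - Y u q (Y om 1 c) else 0)"
    by (intro sum.cong refl) (auto simp: gbinomial_0_left)
  finally have "Y om 1 (Y u q c) - Y u q (Y om 1 c) = Y (Y om 0 u) (1 + q) c + Y (Y om 1 u) q c"
    by simp
  also have "\<dots> = sm (- of_int (1 + q)) (Y u q c) + sm (of_int w) (Y u q c)"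
    using assms by (simp add: Y_translation Vk_def Y_scale_left)
  also have "\<dots> = sm (- of_int (1 + q) + of_int w) (Y u q c)"
    by (simp only: scale_left_distrib)
  also have "- of_int (1 + q) + of_int w = (of_int (w - q - 1) :: complex)" by simp
  finally show ?thesis .
qed

lemma mode_weight:
  assumes "u \<in> Vk sm Y om w" "c \<in> Vk sm Y om k"
  shows "Y u q c \<in> Vk sm Y om (w + k - q - 1)"
proof -
  have "Y om 1 (Y u q c) = sm (of_int (w - q - 1)) (Y u q c) + Y u q (Y om 1 c)"
    using L0_commutator[OF assms(1), of q c] by (simp only: diff_eq_eq)
  also have "Y u q (Y om 1 c) = sm (of_int k) (Y u q c)"
    using assms(2) by (simp add: Vk_def Y_scale_right)
  also have "sm (of_int (w - q - 1)) (Y u q c) + sm (of_int k) (Y u q c)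
      = sm (of_int (w - q - 1) + of_int k) (Y u q c)" by (simp only: scale_left_distrib)
  also have "of_int (w - q - 1) + of_int k = (of_int (w + k - q - 1) :: complex)" by simp
  finally show ?thesis by (simp add: Vk_def)
qed

lemma translation_weight:
  assumes "a \<in> Vk sm Y om w"
  shows "Y om 0 a \<in> Vk sm Y om (w + 1)"
  using mode_weight[OF om_weight assms, of 0] by (simp add: algebra_simps)

text \<open>The Borcherds identity with p = 0 and r = -1: the left side collapses to i = 0, all
  coefficients on the right are 1, and the sign (-1)^r turns the difference into a normally ordered
  sum. It is infinite only formally, hence the cutoff M.\<close>

lemma iterate_minus_one:
  "\<exists>N. \<forall>M\<ge>N. Y (Y a (-1) b) q c
     = (\<Sum>j\<le>M. Y a (- 1 - int j) (Y b (q + int j) c) + Y b (q - 1 - int j) (Y a (int j) c))"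
proof -
  have one: "(-1) ^ i * ((of_int (-1)) gchoose i) = (1 :: complex)" for i
  proof -
    have "(of_int (-1)) gchoose i = (-1) ^ i * (of_nat i gchoose i :: complex)"
      using gbinomial_minus[of "1 :: complex" i] by simp
    also have "(of_nat i gchoose i :: complex) = 1" by (simp flip: binomial_gbinomial)
    finally show ?thesis by (simp flip: power_add)
  qed
  obtain N where N: "\<And>M. M \<ge> N \<Longrightarrow>
        (\<Sum>i=0..M. sm ((of_int 0) gchoose i) (Y (Y a (-1 + int i) b) (0 + q - int i) c))
      = (\<Sum>i=0..M. sm ((-1)^i * ((of_int (-1)) gchoose i))
            (Y a (0 + -1 - int i) (Y b (q + int i) c)
             - sm ((-1) powi (-1)) (Y b (q + -1 - int i) (Y a (0 + int i) c))))"
    using borcherds[of 0 a "-1" b q c] by blast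
  have "Y (Y a (-1) b) q c
     = (\<Sum>j\<le>M. Y a (- 1 - int j) (Y b (q + int j) c) + Y b (q - 1 - int j) (Y a (int j) c))"
    if "M \<ge> N" for M
  proof -
    have "Y (Y a (-1) b) q c = (\<Sum>i=0..M. if i = 0 then Y (Y a (-1) b) q c else 0)" by simp
    also have "\<dots> = (\<Sum>i=0..M. sm ((of_int 0) gchoose i) (Y (Y a (-1 + int i) b) (0 + q - int i) c))"
      by (intro sum.cong refl) (auto simp: gbinomial_0_left)
    also note N[OF that]
    finally show ?thesis unfolding one by (simp add: atLeast0AtMost)
  qed
  then show ?thesis by blast
qed

section \<open>Residues and membership in O_n(V)\<close>

lemma Y_eq_0_above_tb:
  assumes "int (tb Y a b) \<le> m"
  shows "Y a m b = 0"
proof -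
  obtain N where N: "\<forall>m\<ge>N. Y a m b = 0" using Y_truncation by blast
  have "\<forall>m. int (nat N) \<le> m \<longrightarrow> Y a m b = 0" using N by auto
  then have "\<forall>m. int (tb Y a b) \<le> m \<longrightarrow> Y a m b = 0"
    unfolding tb_def by (rule LeastI)
  then show ?thesis using assms by blast
qed

text \<open>Any larger cutoff gives the same residue, so residues of different vectors can be
  compared over one common range.\<close>

lemma resx_eq_sum:
  assumes "M \<ge> tb Y a b + j"
  shows "resx sm Y e j a b = (\<Sum>i\<le>M. sm (e gchoose i) (Y a (int i - int j) b))"
  unfolding resx_def
  by (rule sum.mono_neutral_left) (use assms in \<open>auto intro!: Y_eq_0_above_tb\<close>)

text \<open>Integration by parts: Y(L(-1)a, x) is the derivative of Y(a, x), and the derivative of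
  (1+x)^(e+1) x^(-j) is rewritten with (1+x)^(e+1) = (1+x)^e + x (1+x)^e.\<close>

lemma resx_translation:
  "resx sm Y (e + 1) j (Y om 0 a) b
   = sm (of_nat j) (resx sm Y e (Suc j) a b) + sm (of_nat j - e - 1) (resx sm Y e j a b)"
proof -
  define M where "M = tb Y a b + tb Y (Y om 0 a) b + j"
  let ?x = "\<lambda>i. Y a (int i - int j) b"
  let ?y = "Y a (- 1 - int j) b"
  have idx: "int 0 - int (Suc j) = - 1 - int j" "\<And>i. int (Suc i) - int (Suc j) = int i - int j"
    "\<And>i. int i - int j - 1 = int i - int (Suc j)" by simp_all
  have neg: "- of_int (int i - int j) = (of_nat j - of_nat i :: complex)" for i by simp
  have 1: "resx sm Y (e + 1) j (Y om 0 a) b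
      = sm (of_nat j) ?y + (\<Sum>i\<le>M. sm (((e + 1) gchoose (Suc i)) * (of_nat j - of_nat (Suc i))) (?x i))"
  proof -
    have "resx sm Y (e + 1) j (Y om 0 a) b
      = (\<Sum>i\<le>Suc M. sm ((e + 1) gchoose i) (Y (Y om 0 a) (int i - int j) b))"
      by (rule resx_eq_sum) (simp add: M_def)
    also have "\<dots> = (\<Sum>i\<le>Suc M. sm (((e + 1) gchoose i) * (of_nat j - of_nat i)) (Y a (int i - int (Suc j)) b))"
      by (simp only: Y_translation scale_scale idx(3) neg)
    finally show ?thesis unfolding sum.atMost_Suc_shift idx by simp
  qed
  have 2: "resx sm Y e (Suc j) a b = ?y + (\<Sum>i\<le>M. sm (e gchoose (Suc i)) (?x i))"
  proof -
    have "resx sm Y e (Suc j) a b = (\<Sum>i\<le>Suc M. sm (e gchoose i) (Y a (int i - int (Suc j)) b))"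
      by (rule resx_eq_sum) (simp add: M_def)
    then show ?thesis unfolding sum.atMost_Suc_shift idx by simp
  qed
  have 3: "resx sm Y e j a b = (\<Sum>i\<le>M. sm (e gchoose i) (?x i))"
    by (rule resx_eq_sum) (simp add: M_def)
  \<comment> \<open>Absorption for the part containing i + 1, Pascal's rule for the part containing
    j.\<close>
  have coeff: "((e + 1) gchoose (Suc i)) * (of_nat j - of_nat (Suc i))
     = of_nat j * (e gchoose (Suc i)) + (of_nat j - e - 1) * (e gchoose i)" for i
  proof -
    have "((e + 1) gchoose (Suc i)) * of_nat (Suc i) = (e + 1) * (e gchoose i)"
      using Suc_times_gbinomial[of i e] by (simp only: mult.commute)
    moreover have "((e + 1) gchoose (Suc i)) = (e gchoose i) + (e gchoose (Suc i))"
      by (rule gbinomial_Suc_Suc)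
    ultimately show ?thesis by (simp only: right_diff_distrib) (simp add: algebra_simps)
  qed
  show ?thesis unfolding 1 2 3 coeff
    by (simp only: scale_right_distrib scale_sum_right scale_left_distrib sum.distrib scale_scale add.assoc)
qed

text \<open>The pole order is raised by induction: by \<open>resx_translation\<close> the residue of
  order j + 1 for \<open>a\<close> is a combination of residues of order j for L(-1)a, of weight t +
  1, and for \<open>a\<close>. Division by j > 0 isolates it.\<close>

lemma resx_in_O_n:
  assumes "a \<in> Vk sm Y om t"
  shows "resx sm Y (of_int (t + int n)) (2 * n + 2 + k) a b \<in> O_n sm Y om n"
  using assms
proof (induction k arbitrary: a t)
  case 0
  then have "circ_n sm Y n t a b \<in> O_n sm Y om n"
    unfolding O_n_def by (intro span_base) blast
  then show ?case by (simp add: circ_n_def)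
next
  case (Suc k)
  let ?O = "O_n sm Y om n"
  let ?e = "of_int (t + int n) :: complex"
  define j where "j = 2 * n + 2 + k"
  have IH: "resx sm Y (of_int (t + int n)) j a b \<in> ?O" if "a \<in> Vk sm Y om t" for a t
    using Suc.IH[OF that] by (simp only: j_def)
  have e: "of_int (t + 1 + int n) = ?e + 1" by simp
  have sub: "subspace ?O" unfolding O_n_def by (rule subspace_span)
  have "resx sm Y (?e + 1) j (Y om 0 a) b \<in> ?O"
    using IH[OF translation_weight[OF Suc.prems]] by (simp only: e)
  moreover have "sm (of_nat j - ?e - 1) (resx sm Y ?e j a b) \<in> ?O"
    by (rule subspace_scale[OF sub IH[OF Suc.prems]])
  ultimately have "resx sm Y (?e + 1) j (Y om 0 a) b - sm (of_nat j - ?e - 1) (resx sm Y ?e j a b) \<in> ?O"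
    by (rule subspace_diff[OF sub])
  then have "sm (of_nat j) (resx sm Y ?e (Suc j) a b) \<in> ?O"
    unfolding resx_translation by (simp only: add_diff_cancel_right')
  then have "sm (1 / of_nat j) (sm (of_nat j) (resx sm Y ?e (Suc j) a b)) \<in> ?O"
    by (rule subspace_scale[OF sub])
  moreover have "j > 0" by (simp add: j_def)
  then have "(1 / of_nat j) * of_nat j = (1 :: complex)" by simp
  ultimately have "resx sm Y ?e (Suc j) a b \<in> ?O" by (simp only: scale_scale scale_one)
  then show ?case by (simp add: j_def)
qed

section \<open>Homogeneous components and separating functionals\<close>

lemma weight_vectors_independent:
  assumes "finite K" "\<And>k. k \<in> K \<Longrightarrow> d k \<in> Vk sm Y om k" "(\<Sum>k\<in>K. d k) = 0"
  shows "k \<in> K \<Longrightarrow> d k = 0"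
  using assms
proof (induction K arbitrary: d k rule: finite_induct)
  case empty
  then show ?case by simp
next
  case (insert k0 K)
  \<comment> \<open>Applying L(0) - k0 kills the component of weight \<open>k0\<close> and scales
    the others by nonzero factors.\<close>
  have "(\<Sum>k\<in>K. sm (of_int (k - k0)) (d k))
    = Y om 1 (\<Sum>k\<in>insert k0 K. d k) - sm (of_int k0) (\<Sum>k\<in>insert k0 K. d k)"
  proof -
    have "Y om 1 (d k) = sm (of_int k) (d k)" if "k \<in> insert k0 K" for k
      using insert.prems(2)[OF that] by (simp add: Vk_def)
    then have "Y om 1 (\<Sum>k\<in>insert k0 K. d k) = (\<Sum>k\<in>insert k0 K. sm (of_int k) (d k))"
      unfolding Y_sum_right by (intro sum.cong) auto
    then show ?thesis using insert.hyps
      by (simp add: scale_left_diff_distrib sum_subtractf scale_right_distrib scale_sum_right)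
  qed
  then have sum0: "(\<Sum>k\<in>K. sm (of_int (k - k0)) (d k)) = 0" using insert.prems(3) by simp
  have K: "d k = 0" if "k \<in> K" for k
  proof -
    have "sm (of_int (k - k0)) (d k) = 0"
    proof (rule insert.IH[OF that _ sum0])
      fix k assume "k \<in> K"
      then show "sm (of_int (k - k0)) (d k) \<in> Vk sm Y om k"
        using insert.prems(2)[of k] by (simp add: Vk_def Y_scale_right mult.commute)
    qed
    moreover have "k \<noteq> k0" using that insert.hyps by auto
    ultimately show ?thesis by simp
  qed
  then have "d k0 = 0" using insert.prems(3) insert.hyps by simp
  then show ?case using K insert.prems(1) by auto
qed

text \<open>\<open>hcomp\<close> is a definite description, so uniqueness must be proved: the
  difference of two decompositions is a vanishing sum of weight vectors.\<close>

lemma hcomp_homogeneous: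
  assumes a: "a \<in> Vk sm Y om t"
  shows "hcomp sm Y om a = (\<lambda>k. if k = t then a else 0)"
  unfolding hcomp_def
proof (rule the_equality)
  have zero: "0 \<in> Vk sm Y om k" for k by (simp add: Vk_def)
  have "{k. (if k = t then a else 0) \<noteq> 0} \<subseteq> {t}" by auto
  moreover from this have "finite {k. (if k = t then a else 0) \<noteq> 0}" by (rule finite_subset) simp
  moreover have "(\<Sum>k\<in>{k. (if k = t then a else 0) \<noteq> 0}. if k = t then a else 0)
      = (\<Sum>k\<in>{t}. if k = t then a else 0)"
    by (rule sum.mono_neutral_left) auto
  ultimately show "finite {k. (if k = t then a else 0) \<noteq> 0} \<and> (\<forall>k. (if k = t then a else 0) \<in> Vk sm Y om k)
     \<and> a = (\<Sum>k\<in>{k. (if k = t then a else 0) \<noteq> 0}. if k = t then a else 0)"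
    using a zero by auto
  fix c assume c: "finite {k. c k \<noteq> 0} \<and> (\<forall>k. c k \<in> Vk sm Y om k) \<and> a = (\<Sum>k\<in>{k. c k \<noteq> 0}. c k)"
  define K where "K = insert t {k. c k \<noteq> 0}"
  define d where "d = (\<lambda>k. c k - (if k = t then a else 0))"
  have K: "finite K" using c by (simp add: K_def)
  have "(\<Sum>k\<in>K. c k) = a"
    using c by (auto simp: K_def intro!: sum.mono_neutral_right)
  then have "(\<Sum>k\<in>K. d k) = 0" using K by (simp add: d_def sum_subtractf K_def)
  moreover have "d k \<in> Vk sm Y om k" for k
    using c a by (auto simp: d_def Vk_def Y_diff_right scale_right_diff_distrib)
  ultimately have "d k = 0" if "k \<in> K" for k using weight_vectors_independent[OF K] that by blast
  then have "d k = 0" for k by (cases "k \<in> K") (auto simp: K_def d_def)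
  then show "c = (\<lambda>k. if k = t then a else 0)" by (simp add: fun_eq_iff d_def)
qed

lemma star_n_homogeneous:
  assumes "a \<in> Vk sm Y om t"
  shows "star_n sm Y om n a b = star_hom sm Y n t a b"
proof -
  \<comment> \<open>For \<open>a = 0\<close> the index set of \<open>star_n\<close> is empty, but
    the added summand is then zero.\<close>
  have "star_n sm Y om n a b = (\<Sum>k\<in>{t}. star_hom sm Y n k (if k = t then a else 0) b)"
    unfolding star_n_def hcomp_homogeneous[OF assms]
    by (rule sum.mono_neutral_left) (auto simp: star_hom_def resx_def)
  then show ?thesis by simp
qed

text \<open>The coordinate of \<open>x\<close> in a basis that extends a basis of \<open>W\<close>
  together with \<open>x\<close>.\<close>

lemma separating_functional:
  assumes "subspace W" "x \<notin> W"
  obtains f :: "'v \<Rightarrow> complex" where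
    "\<And>a b. f (a + b) = f a + f b" "\<And>s a. f (sm s a) = s * f a" "\<And>v. v \<in> W \<Longrightarrow> f v = 0" "f x \<noteq> 0"
proof -
  obtain B where B: "B \<subseteq> W" "independent B" "span B = W"
    using maximal_independent_subset[of W] span_minimal[OF _ assms(1)] by (metis subset_antisym)
  then have ind: "independent (insert x B)" using assms(2) by (simp add: independent_insert)
  define C where "C = extend_basis (insert x B)"
  have C: "insert x B \<subseteq> C" "independent C" "span C = UNIV"
    using extend_basis_superset[OF ind] independent_extend_basis[OF ind] span_extend_basis[OF ind]
    by (auto simp: C_def)
  define f where "f = (\<lambda>v. representation C v x)"
  have add: "f (a + b) = f a + f b" and scale: "f (sm s a) = s * f a" for a b s
    using C by (simp_all add: f_def representation_add representation_scale)
  have "f x \<noteq> 0" using C by (simp add: f_def representation_basis)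
  moreover have "f v = 0" if "v \<in> W" for v
  proof -
    have "v \<in> span B" using that B by simp
    then show ?thesis
    proof (induction rule: span_induct_alt)
      case base
      then show ?case by (simp add: f_def representation_zero)
    next
      case (step c y z)
      moreover have "y \<noteq> x" using step.hyps(1) B(1) assms(2) by blast
      ultimately have "f y = 0" using C by (auto simp: f_def representation_basis)
      then show ?case using step by (simp add: add scale)
    qed
  qed
  ultimately show ?thesis using that add scale by blast
qed

end

section \<open>The filtration\<close>

context voa
begin

text \<open>As \<open>f\<close> kills the nonnegative modes, the residue against x^(-j-1) is the
  coefficient of x^j in an ordinary product of power series.\<close>

lemma functional_resx:
  assumes add: "\<And>a b. f (a + b) = f a + f b" and scale: "\<And>s a. f (sm s a) = s * (f a :: complex)"
    and pos: "\<And>m. m \<ge> 0 \<Longrightarrow> f (Y a m b) = 0"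
  shows "f (resx sm Y e (Suc j) a b)
    = fps_nth (fps_binomial e * Abs_fps (\<lambda>s. f (Y a (- 1 - int s) b))) j"
proof -
  have "f 0 = 0" using scale[of 0 0] by simp
  then have sum: "f (\<Sum>x\<in>A. g x) = (\<Sum>x\<in>A. f (g x))" for A :: "nat set" and g
    by (induction A rule: infinite_finite_induct) (auto simp: add)
  have "f (resx sm Y e (Suc j) a b)
     = (\<Sum>i=0..tb Y a b + Suc j. (e gchoose i) * f (Y a (int i - int (Suc j)) b))"
    by (simp only: resx_def sum scale)
  also have "\<dots> = (\<Sum>i=0..j. (e gchoose i) * f (Y a (int i - int (Suc j)) b))"
    by (rule sum.mono_neutral_right) (auto simp: pos)
  also have "\<dots> = (\<Sum>i=0..j. (e gchoose i) * f (Y a (- 1 - int (j - i)) b))"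
    by (intro sum.cong refl arg_cong2[where f="(*)"] arg_cong[where f=f] arg_cong[where f="\<lambda>m. Y a m b"]) auto
  finally show ?thesis by (simp add: fps_mult_nth)
qed

text \<open>The passage from the algebra to power series: residues of order 2n + 2 + k lie in O_n(V)
  and are the coefficients beyond 2n, while the star product gives the alternating sum.\<close>

lemma adm_modes:
  assumes W: "O_n sm Y om n \<subseteq> W" "star_n sm Y om n a b \<in> W" and a: "a \<in> Vk sm Y om t"
    and add: "\<And>a b. f (a + b) = f a + f b" and scale: "\<And>s a. f (sm s a) = s * (f a :: complex)"
    and f: "\<And>v. v \<in> W \<Longrightarrow> f v = 0" and pos: "\<And>m. m \<ge> 0 \<Longrightarrow> Y a m b \<in> W"
  shows "adm n t (Abs_fps (\<lambda>s. f (Y a (- 1 - int s) b)))"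
  unfolding adm_def
proof (intro conjI allI impI)
  let ?H = "fps_binomial (of_int (t + int n)) * Abs_fps (\<lambda>s. f (Y a (- 1 - int s) b))"
  have resx: "f (resx sm Y (of_int (t + int n)) (Suc j) a b) = fps_nth ?H j" for j
    by (rule functional_resx[OF add scale]) (simp add: f pos)
  have "f 0 = 0" using scale[of 0 0] by simp
  then have sum: "f (\<Sum>x\<in>A. g x) = (\<Sum>x\<in>A. f (g x))" for A :: "nat set" and g
    by (induction A rule: infinite_finite_induct) (auto simp: add)
  show "fps_nth ?H j = 0" if "2 * n < j" for j
  proof -
    define k where "k = j - (2 * n + 1)"
    have k: "Suc j = 2 * n + 2 + k" using that by (simp add: k_def)
    have "resx sm Y (of_int (t + int n)) (Suc j) a b \<in> W"
      unfolding k by (rule subsetD[OF W(1) resx_in_O_n[OF a]])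
    then show ?thesis using f resx[of j] by metis
  qed
  have "f (star_hom sm Y n t a b) = 0"
    using f W(2) by (simp add: star_n_homogeneous[OF a])
  also have "star_hom sm Y n t a b = (\<Sum>m=0..n. sm ((-1)^m * of_nat ((m + n) choose n))
      (resx sm Y (of_int (t + int n)) (Suc (n + m)) a b))"
    by (simp add: star_hom_def)
  finally show "(\<Sum>m=0..n. (-1) ^ m * of_nat ((m + n) choose n) * fps_nth ?H (n + m)) = 0"
    unfolding sum scale resx .
qed

text \<open>The shift by one lets the indices run over all naturals and serve as exponents of power
  series.\<close>

definition monomial :: "'v \<Rightarrow> nat list \<Rightarrow> 'v" where
  "monomial u es = foldr (\<lambda>e. Y u (- 1 - int e)) es vac"

lemma monomial_Nil [simp]: "monomial u [] = vac"
  and monomial_Cons [simp]: "monomial u (e # es) = Y u (- 1 - int e) (monomial u es)"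
  by (simp_all add: monomial_def)

lemma monomial_eq_app: "monomial u es = app Y (map (\<lambda>e. (u, - 1 - int e)) es) vac"
  by (induction es) simp_all

lemma app_eq_monomial:
  assumes "\<forall>k\<in>set ks. k \<ge> 1"
  shows "app Y (map (\<lambda>k. (u, - k)) ks) vac = monomial u (map (\<lambda>k. nat (k - 1)) ks)"
  using assms by (induction ks) simp_all

lemma app_monomials:
  "{app Y (map (\<lambda>k. (u, - k)) ks) vac | ks. Q (length ks) \<and> (\<forall>k\<in>set ks. k \<ge> 1)}
   = {monomial u es | es. Q (length es)}"
proof (intro equalityI subsetI)
  fix v assume "v \<in> {app Y (map (\<lambda>k. (u, - k)) ks) vac | ks. Q (length ks) \<and> (\<forall>k\<in>set ks. k \<ge> 1)}"
  then obtain ks where ks: "v = app Y (map (\<lambda>k. (u, - k)) ks) vac" "Q (length ks)" "\<forall>k\<in>set ks. k \<ge> 1"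
    by blast
  have "v = monomial u (map (\<lambda>k. nat (k - 1)) ks)" using ks app_eq_monomial by simp
  then show "v \<in> {monomial u es | es. Q (length es)}" using ks(2) by force
next
  fix v assume "v \<in> {monomial u es | es. Q (length es)}"
  then obtain es where es: "v = monomial u es" "Q (length es)" by blast
  define ks where "ks = map (\<lambda>e. 1 + int e) es"
  have "v = app Y (map (\<lambda>k. (u, - k)) ks) vac"
    by (simp add: es(1) monomial_eq_app ks_def comp_def algebra_simps)
  moreover have "Q (length ks)" "\<forall>k\<in>set ks. k \<ge> 1" using es by (auto simp: ks_def)
  ultimately show "v \<in> {app Y (map (\<lambda>k. (u, - k)) ks) vac | ks. Q (length ks) \<and> (\<forall>k\<in>set ks. k \<ge> 1)}"
    by blast
qed

lemma F_r_eq: "F_r sm Y u p vac = span {monomial u es | es. length es \<le> p}"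
  unfolding F_r_def using app_monomials[of u "\<lambda>l. l \<le> p"] by simp

lemma Vu_eq: "Vu sm Y vac u = span {monomial u es | es. True}"
  unfolding Vu_def using app_monomials[of u "\<lambda>l. True"] by simp

lemma monomial_in_Vu: "monomial u es \<in> Vu sm Y vac u"
  unfolding Vu_eq by (intro span_base) blast

lemma subspace_F: "subspace (F_r sm Y u p vac)"
  unfolding F_r_eq by (rule subspace_span)

lemma monomial_in_F: "length es \<le> p \<Longrightarrow> monomial u es \<in> F_r sm Y u p vac"
  unfolding F_r_eq by (intro span_base) blast

lemma F_mono: "p \<le> q \<Longrightarrow> F_r sm Y u p vac \<subseteq> F_r sm Y u q vac"
  unfolding F_r_eq by (intro span_mono) (auto intro: le_trans)

lemma creation_mode_in_F:
  assumes "v \<in> F_r sm Y u p vac"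
  shows "Y u (- 1 - int e) v \<in> F_r sm Y u (Suc p) vac"
proof (rule Y_span_right[OF assms[unfolded F_r_eq] subspace_F])
  fix x assume "x \<in> {monomial u es |es. length es \<le> p}"
  then obtain es where "x = monomial u es" "length es \<le> p" by blast
  then show "Y u (- 1 - int e) x \<in> F_r sm Y u (Suc p) vac"
    using monomial_in_F[of "e # es" "Suc p" u] by simp
qed

lemma upow_eq_monomial: "(Y u (-1) ^^ i) vac = monomial u (replicate i 0)"
  by (induction i) simp_all

lemma upow_weight:
  assumes "u \<in> Vk sm Y om w"
  shows "(Y u (-1) ^^ i) vac \<in> Vk sm Y om (int i * w)"
proof (induction i)
  case 0
  show ?case using vac_weight by simp
next
  case (Suc i)
  have "w + int i * w - (-1) - 1 = int (Suc i) * w" by (simp add: algebra_simps)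
  then show ?case using mode_weight[OF assms Suc, of "-1"] by simp
qed

end

locale voa_perm = voa +
  fixes u
  assumes perm: "perm_prop sm Y vac u"
begin

abbreviation "F p \<equiv> F_r sm Y u p vac"

text \<open>The permutation property for modes of \<open>u\<close> alone acting on the vacuum;
  \<open>u\<close> itself is the monomial u_(-1) 1.\<close>

lemma permD:
  assumes "xs \<noteq> []" "mset ys = mset xs"
  shows "app Y (map (\<lambda>m. (u, m)) xs) vac - app Y (map (\<lambda>m. (u, m)) ys) vac \<in> F (length xs - 1)"
proof -
  have u: "u \<in> Vu sm Y vac u"
    using monomial_in_Vu[of u "[0]"] by (simp add: Y_creation)
  have v: "vac \<in> Vu sm Y vac u" using monomial_in_Vu[of u "[]"] by simp
  let ?g = "\<lambda>m. (u, - m :: int)"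
  have "mset (map ?g ys) = mset (map ?g xs)" using assms(2) by simp
  moreover have "length (map ?g xs) \<ge> 1" using assms(1) by (simp add: Suc_le_eq)
  moreover have "\<forall>(a, k)\<in>set (map ?g xs). a \<in> Vu sm Y vac u" using u by auto
  ultimately have "app Y (map (\<lambda>(a, k). (a, - k)) (map ?g xs)) vac
      - app Y (map (\<lambda>(a, k). (a, - k)) (map ?g ys)) vac \<in> F (length (map ?g xs) - 1)"
    using perm v unfolding perm_prop_def by blast
  then show ?thesis by (simp add: comp_def)
qed

lemma monomial_perm:
  assumes "es \<noteq> []" "mset es' = mset es"
  shows "monomial u es - monomial u es' \<in> F (length es - 1)"
proof -
  let ?xs = "map (\<lambda>e. - 1 - int e) es" and ?ys = "map (\<lambda>e. - 1 - int e) es'"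
  have "?xs \<noteq> []" "mset ?ys = mset ?xs" using assms by simp_all
  from permD[OF this] show ?thesis by (simp add: monomial_eq_app comp_def)
qed

text \<open>The mode is moved to the far right, where it kills the vacuum. The permutation error has
  one factor less than the whole word, which is the original length.\<close>

lemma annihilation_mode_in_F:
  assumes "v \<in> F p" "m \<ge> 0"
  shows "Y u m v \<in> F p"
proof (rule Y_span_right[OF assms(1)[unfolded F_r_eq] subspace_F])
  fix x assume "x \<in> {monomial u es |es. length es \<le> p}"
  then obtain es where es: "x = monomial u es" "length es \<le> p" by blast
  let ?es = "map (\<lambda>e. - 1 - int e) es"
  have app0: "app Y (map (\<lambda>m. (u, m)) (ms @ [m])) vac = 0" for ms
    by (induction ms) (simp_all add: Y_vac_right[OF assms(2)])
  have "app Y (map (\<lambda>m. (u, m)) (m # ?es)) vac - app Y (map (\<lambda>m. (u, m)) (?es @ [m])) vac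
      \<in> F (length (m # ?es) - 1)"
    by (rule permD) simp_all
  then have "app Y (map (\<lambda>m. (u, m)) (m # ?es)) vac \<in> F (length es)"
    unfolding app0 by simp
  then have "Y u m x \<in> F (length es)" by (simp add: es(1) monomial_eq_app comp_def)
  then show "Y u m x \<in> F p" using F_mono[OF es(2)] by blast
qed

abbreviation "upow i \<equiv> (Y u (-1) ^^ i) vac"

lemma upow_Suc_mode_in:
  assumes T: "subspace T"
    and 1: "\<And>j. Y u (- 1 - int j) (Y (upow i) (m + int j) v) \<in> T"
    and 2: "\<And>j. Y (upow i) (m - 1 - int j) (Y u (int j) v) \<in> T"
  shows "Y (upow (Suc i)) m v \<in> T"
proof -
  obtain N where N: "\<forall>M\<ge>N. Y (Y u (-1) (upow i)) m v
      = (\<Sum>j\<le>M. Y u (- 1 - int j) (Y (upow i) (m + int j) v) + Y (upow i) (m - 1 - int j) (Y u (int j) v))"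
    using iterate_minus_one[of u "upow i" m v] by blast
  have "(\<Sum>j\<le>N. Y u (- 1 - int j) (Y (upow i) (m + int j) v) + Y (upow i) (m - 1 - int j) (Y u (int j) v)) \<in> T"
    by (intro subspace_sum[OF T] subspace_add[OF T] 1 2)
  then show ?thesis using N[rule_format, OF order_refl] by simp
qed

lemma upow_mode_in_F: "v \<in> F p \<Longrightarrow> Y (upow i) m v \<in> F (p + i)"
proof (induction i arbitrary: v m)
  case 0
  then show ?case using subspace_0[OF subspace_F] by (simp add: Y_vac_left)
next
  case (Suc i)
  show ?case
  proof (rule upow_Suc_mode_in[OF subspace_F])
    show "Y u (- 1 - int j) (Y (upow i) (m + int j) v) \<in> F (p + Suc i)" for j
      using creation_mode_in_F[OF Suc.IH[OF Suc.prems]] by simp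
    show "Y (upow i) (m - 1 - int j) (Y u (int j) v) \<in> F (p + Suc i)" for j
      using Suc.IH[OF annihilation_mode_in_F[OF Suc.prems, of "int j"]] F_mono[of "p + i" "p + Suc i" u] by auto
  qed
qed

text \<open>One factor is saved: in each term of the iterate formula either the remaining power
  still acts by a nonnegative mode, or \<open>u\<close> does.\<close>

lemma upow_annihilation_mode_in_F:
  "v \<in> F p \<Longrightarrow> m \<ge> 0 \<Longrightarrow> Y (upow (Suc i)) m v \<in> F (p + i)"
proof (induction i arbitrary: m)
  case 0
  then show ?case using annihilation_mode_in_F by (simp add: Y_creation)
next
  case (Suc i)
  show ?case
  proof (rule upow_Suc_mode_in[OF subspace_F])
    show "Y u (- 1 - int j) (Y (upow (Suc i)) (m + int j) v) \<in> F (p + Suc i)" for j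
      using creation_mode_in_F[OF Suc.IH[OF Suc.prems(1), of "m + int j"]] Suc.prems(2) by simp
    show "Y (upow (Suc i)) (m - 1 - int j) (Y u (int j) v) \<in> F (p + Suc i)" for j
      by (intro upow_mode_in_F annihilation_mode_in_F Suc.prems) simp
  qed
qed

lemma creation_upow_annihilation_in_F:
  assumes "v \<in> F p" "m \<ge> 0"
  shows "Y u (- 1 - int j) (Y (upow i) m v) \<in> F (p + i)"
proof (cases i)
  case 0
  then show ?thesis using assms(2) subspace_0[OF subspace_F] by (simp add: Y_vac_left)
next
  case (Suc k)
  then show ?thesis
    using creation_mode_in_F[OF upow_annihilation_mode_in_F[OF assms, of k]] by simp
qed

text \<open>Modulo shorter monomials, the modes of u_(-1)^i 1 are the coefficients of the i-th power
  of the creation part of Y(u, x). The exact case i = 0 is kept apart: for empty \<open>bs\<close>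
  truncated subtraction would give \<open>F 0\<close>, and the next creation mode would leave the
  target.\<close>

lemma upow_mode_monomial:
  "Y (upow i) (- 1 - int s) (monomial u bs) - (\<Sum>es\<in>weak_compositions i s. monomial u (es @ bs))
     \<in> (if i = 0 then {0} else F (length bs + i - 1))"
proof (induction i arbitrary: s)
  case 0
  then show ?case by (simp add: Y_vac_left weak_compositions_0)
next
  case (Suc i)
  let ?b = "monomial u bs" and ?T = "F (length bs + i)"
  have b: "?b \<in> F (length bs)" by (rule monomial_in_F) simp
  obtain N where N: "\<forall>M\<ge>N. Y (Y u (-1) (upow i)) (- 1 - int s) ?b
      = (\<Sum>j\<le>M. Y u (- 1 - int j) (Y (upow i) (- 1 - int s + int j) ?b)
          + Y (upow i) (- 1 - int s - 1 - int j) (Y u (int j) ?b))"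
    using iterate_minus_one[of u "upow i" "- 1 - int s" ?b] by blast
  \<comment> \<open>Large enough for the iterate formula and for all j \<le> s.\<close>
  define M where "M = N + s"
  have low: "Y (upow i) (- 1 - int s - 1 - int j) (Y u (int j) ?b) \<in> ?T" for j
    by (intro upow_mode_in_F annihilation_mode_in_F b) simp
  \<comment> \<open>For j \<le> s the power acts by a creation mode and the induction hypothesis
    applies; for j > s it acts by a nonnegative mode and only shorter terms arise.\<close>
  have lead: "Y u (- 1 - int j) (Y (upow i) (- 1 - int s + int j) ?b)
      - (if j \<le> s then \<Sum>es\<in>weak_compositions i (s - j). monomial u ((j # es) @ bs) else 0) \<in> ?T" for j
  proof (cases "j \<le> s")
    case True
    then have j: "- 1 - int s + int j = - 1 - int (s - j)" by simp
    let ?D = "Y (upow i) (- 1 - int (s - j)) ?b - (\<Sum>es\<in>weak_compositions i (s - j). monomial u (es @ bs))"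
    have "Y u (- 1 - int j) ?D \<in> ?T"
    proof (cases i)
      case 0
      then show ?thesis using Suc.IH[of "s - j"] subspace_0[OF subspace_F] by simp
    next
      case (Suc k)
      then show ?thesis using creation_mode_in_F[of ?D u "length bs + k" j] Suc.IH[of "s - j"] by simp
    qed
    then show ?thesis using True by (simp add: j Y_diff_right Y_sum_right)
  next
    case False
    then show ?thesis using creation_upow_annihilation_in_F[OF b, of "- 1 - int s + int j" j i] by simp
  qed
  have "(\<Sum>j\<le>M. (Y u (- 1 - int j) (Y (upow i) (- 1 - int s + int j) ?b)
      - (if j \<le> s then \<Sum>es\<in>weak_compositions i (s - j). monomial u ((j # es) @ bs) else 0))
      + Y (upow i) (- 1 - int s - 1 - int j) (Y u (int j) ?b)) \<in> ?T"
    by (intro subspace_sum[OF subspace_F] subspace_add[OF subspace_F] low lead)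
  also have "(\<Sum>j\<le>M. (Y u (- 1 - int j) (Y (upow i) (- 1 - int s + int j) ?b)
      - (if j \<le> s then \<Sum>es\<in>weak_compositions i (s - j). monomial u ((j # es) @ bs) else 0))
      + Y (upow i) (- 1 - int s - 1 - int j) (Y u (int j) ?b))
    = Y (upow (Suc i)) (- 1 - int s) ?b
      - (\<Sum>j\<le>M. if j \<le> s then \<Sum>es\<in>weak_compositions i (s - j). monomial u ((j # es) @ bs) else 0)"
  proof -
    have "Y (upow (Suc i)) (- 1 - int s) ?b = (\<Sum>j\<le>M. Y u (- 1 - int j) (Y (upow i) (- 1 - int s + int j) ?b)
          + Y (upow i) (- 1 - int s - 1 - int j) (Y u (int j) ?b))"
      using N[rule_format, of M] by (simp add: M_def)
    then show ?thesis by (simp only: sum.distrib sum_subtractf) simp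
  qed
  also have "(\<Sum>j\<le>M. if j \<le> s then \<Sum>es\<in>weak_compositions i (s - j). monomial u ((j # es) @ bs) else 0)
    = (\<Sum>j\<le>s. \<Sum>es\<in>weak_compositions i (s - j). monomial u ((j # es) @ bs))"
    by (rule sum.mono_neutral_cong_right) (auto simp: M_def)
  finally show ?case unfolding sum_weak_compositions_Suc by simp
qed

end

section \<open>Generation\<close>

context voa
begin

lemma gen_n_eqI:
  assumes "S \<subseteq> T"
    and "\<And>W. subspace W \<Longrightarrow> O_n sm Y om n \<subseteq> W \<Longrightarrow> S \<subseteq> W \<Longrightarrow>
      \<forall>a\<in>W. \<forall>b\<in>W. star_n sm Y om n a b \<in> W \<Longrightarrow> T \<subseteq> W"
  shows "gen_n sm Y om n T = gen_n sm Y om n S"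
  unfolding gen_n_def
proof (intro arg_cong[where f=Inter] Collect_cong iffI conjI; elim conjE)
  show "S \<subseteq> W" if "T \<subseteq> W" for W using assms(1) that by (rule subset_trans)
qed (assumption | rule assms(2))+

text \<open>The shift of indices makes \<open>i (Suc e)\<close> the multiplicity of e; in particular
  \<open>i 1\<close> counts the zeros.\<close>

lemma mon_eq_monomial:
  "\<exists>es. mon Y u i vac r = monomial u es \<and> (\<forall>e. count (mset es) e = (if e < r then i (Suc e) else 0))"
proof (induction r)
  case 0
  show ?case by (rule exI[of _ "[]"]) simp
next
  case (Suc r)
  then obtain es where es: "mon Y u i vac r = monomial u es"
    "\<And>e. count (mset es) e = (if e < r then i (Suc e) else 0)" by blast
  have "(Y u (- int (Suc r)) ^^ k) (monomial u es) = monomial u (replicate k r @ es)" for k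
    by (induction k) (simp_all add: algebra_simps)
  moreover have "count (mset (replicate (i (Suc r)) r @ es)) e = (if e < Suc r then i (Suc e) else 0)" for e
    using es(2) by (auto simp: mset_replicate less_Suc_eq)
  ultimately show ?case using es(1) by (metis mon.simps(2))
qed

lemma mon_in_Vu: "mon Y u i vac r \<in> Vu sm Y vac u"
  using mon_eq_monomial monomial_in_Vu by metis

lemma upow_in_Vu: "(Y u (-1) ^^ i) vac \<in> Vu sm Y vac u"
  unfolding upow_eq_monomial by (rule monomial_in_Vu)

end

context voa_perm
begin

lemma monomial_mset:
  assumes f: "\<And>v. v \<in> F p \<Longrightarrow> f v = (0::complex)" and add: "\<And>a b. f (a + b) = f a + f b"
    and "length es = Suc p" "mset es' = mset es"
  shows "f (monomial u es') = f (monomial u es)"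
proof -
  have "es \<noteq> []" using assms(3) by auto
  then have "monomial u es - monomial u es' \<in> F p"
    using monomial_perm[OF _ assms(4)] assms(3) by simp
  then have "f (monomial u es - monomial u es') = 0" by (rule f)
  then show ?thesis using add[of "monomial u es - monomial u es'" "monomial u es'"] by simp
qed

lemma F_subset:
  assumes n: "n \<ge> 1" and u: "u \<in> Vk sm Y om w" and w: "w \<ge> - int n"
    and W: "subspace W" "O_n sm Y om n \<subseteq> W" "\<And>a b. a \<in> W \<Longrightarrow> b \<in> W \<Longrightarrow> star_n sm Y om n a b \<in> W"
    and S1: "\<And>i. - int n \<le> int (i 1) * w \<Longrightarrow> int (i 1) * w \<le> int n \<Longrightarrow> mon Y u i vac (2 * n) \<in> W"
    and S2: "\<And>j. j \<ge> 1 \<Longrightarrow> upow j \<in> W"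
  shows "F p \<subseteq> W"
proof (induction p)
  case 0
  \<comment> \<open>The generator with all exponents 0 is the vacuum.\<close>
  have "mon Y u (\<lambda>_. 0) vac (2 * n) \<in> W" by (rule S1) auto
  moreover have "mon Y u (\<lambda>_. 0) vac r = vac" for r by (induction r) simp_all
  ultimately have "vac \<in> W" by simp
  then show ?case unfolding F_r_eq by (intro span_minimal W(1)) auto
next
  case (Suc p)
  have "monomial u es \<in> W" if len: "length es = Suc p" for es
  proof (rule ccontr)
    assume "monomial u es \<notin> W"
    then obtain f :: "'a \<Rightarrow> complex" where add: "\<And>a b. f (a + b) = f a + f b"
      and scale: "\<And>s a. f (sm s a) = s * f a" and f: "\<And>v. v \<in> W \<Longrightarrow> f v = 0"
      and nz: "f (monomial u es) \<noteq> 0"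
      using separating_functional[OF W(1)] by blast
    have f0: "f v = 0" if "v \<in> F p" for v using that Suc.IH f by blast
    \<comment> \<open>The sorted list is an arbitrary choice of arrangement;
      \<open>monomial_mset\<close> makes the value independent of it.\<close>
    define \<Phi> where "\<Phi> = (\<lambda>M. f (monomial u (sorted_list_of_multiset M)))"
    have \<Phi>: "f (monomial u es) = \<Phi> (mset es)" if "length es = Suc p" for es
      unfolding \<Phi>_def by (rule monomial_mset[OF f0 add, symmetric]) (simp_all add: that)
    have zero: "f 0 = 0" using scale[of 0 0] by simp
    have sum: "f (\<Sum>x\<in>A. g x) = (\<Sum>x\<in>A. f (g x))" for A :: "nat list set" and g
      by (induction A rule: infinite_finite_induct) (auto simp: add zero)
    interpret correlation \<Phi> n "Suc p" w
    proof
      show "n \<ge> 1" "w \<ge> - int n" by fact+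
    next
      fix i :: nat and M :: "nat multiset"
      assume i: "1 \<le> i" and size: "size M + i = Suc p"
      define bs where "bs = sorted_list_of_multiset M"
      have bs: "mset bs = M" "length bs + i = Suc p" using size by (simp_all add: bs_def flip: size_mset)
      have b: "monomial u bs \<in> F (length bs)" by (rule monomial_in_F) simp
      have "adm n (int i * w) (Abs_fps (\<lambda>s. f (Y (upow i) (- 1 - int s) (monomial u bs))))"
      proof (rule adm_modes[OF W(2) W(3) upow_weight[OF u] add scale f])
        show "upow i \<in> W" by (rule S2[OF i])
        have "F (length bs) \<subseteq> F p" using bs(2) i by (intro F_mono) simp
        then show "monomial u bs \<in> W" using b Suc.IH by blast
        fix m :: int assume m: "m \<ge> 0"
        \<comment> \<open>With i \<ge> 1, a nonnegative mode of \<open>upow i\<close> adds at most i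
          - 1 factors, so it stays in the step \<open>F p\<close> already treated.\<close>
        obtain k where k: "i = Suc k" using i by (cases i) auto
        have "length bs + k = p" using bs(2) k by simp
        then have "Y (upow i) m (monomial u bs) \<in> F p"
          using upow_annihilation_mode_in_F[OF b m, of k] k by simp
        then show "Y (upow i) m (monomial u bs) \<in> W" using Suc.IH by blast
      qed
      moreover have "f (Y (upow i) (- 1 - int s) (monomial u bs)) = (\<Sum>es\<in>weak_compositions i s. \<Phi> (mset es + M))" for s
      proof -
        let ?S = "\<Sum>es\<in>weak_compositions i s. monomial u (es @ bs)"
        have "Y (upow i) (- 1 - int s) (monomial u bs) - ?S \<in> F p"
          using upow_mode_monomial[of i s bs] bs(2) i by (simp split: if_splits)
        then have "f (Y (upow i) (- 1 - int s) (monomial u bs) - ?S) = 0" by (rule f0)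
        then have "f (Y (upow i) (- 1 - int s) (monomial u bs)) = f ?S"
          using add[of "Y (upow i) (- 1 - int s) (monomial u bs) - ?S" ?S] by simp
        also have "\<dots> = (\<Sum>es\<in>weak_compositions i s. \<Phi> (mset es + M))"
          unfolding sum
        proof (intro sum.cong refl)
          fix es assume "es \<in> weak_compositions i s"
          then have "length (es @ bs) = Suc p" using bs(2) by (simp add: weak_compositions_def)
          then show "f (monomial u (es @ bs)) = \<Phi> (mset es + M)" using \<Phi>[of "es @ bs"] bs(1) by simp
        qed
        finally show ?thesis .
      qed
      ultimately show "adm n (int i * w) (Abs_fps (\<lambda>s. \<Sum>es\<in>weak_compositions i s. \<Phi> (mset es + M)))"
        by simp
    next
      fix M :: "nat multiset"
      assume size: "size M = Suc p" and small: "\<And>e. e \<in># M \<Longrightarrow> e < 2 * n"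
        and or: "\<bar>int (count M 0) * w\<bar> \<le> int n \<or> M = replicate_mset (Suc p) 0"
      have *: "\<Phi> M = 0" if "mset es = M" "monomial u es \<in> W" for es
        using \<Phi>[of es] f[OF that(2)] that(1) size by auto
      from or show "\<Phi> M = 0"
      proof
        assume small0: "\<bar>int (count M 0) * w\<bar> \<le> int n"
        \<comment> \<open>Exponent k belongs to the mode -k, hence to index k - 1; thus
          \<open>i 1\<close> is the number of zeros of \<open>M\<close> and \<open>S1\<close>
          applies.\<close>
        define i where "i = (\<lambda>k. count M (k - 1))"
        obtain es where es: "mon Y u i vac (2 * n) = monomial u es"
          "\<And>e. count (mset es) e = (if e < 2 * n then i (Suc e) else 0)"
          using mon_eq_monomial[of u i "2 * n"] by blast
        have "mset es = M"
        proof (rule multiset_eqI)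
          fix e
          have "count (mset es) e = (if e < 2 * n then count M e else 0)" unfolding es(2) i_def by simp
          also have "\<dots> = count M e" using small[of e] count_eq_zero_iff[of M e] by auto
          finally show "count (mset es) e = count M e" .
        qed
        moreover have "mon Y u i vac (2 * n) \<in> W"
          using small0 by (intro S1) (auto simp: i_def)
        ultimately show ?thesis using * es(1) by simp
      next
        assume "M = replicate_mset (Suc p) 0"
        moreover have "monomial u (replicate (Suc p) 0) \<in> W"
          using S2[of "Suc p"] unfolding upow_eq_monomial by simp
        ultimately show ?thesis using *[of "replicate (Suc p) 0"] by (metis mset_replicate)
      qed
    qed
    have "\<Phi> (mset es) = 0" by (rule vanishes) (simp add: len)
    then show False using nz \<Phi>[OF len] by simp
  qed
  moreover have "monomial u es \<in> W" if "length es \<le> p" for es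
    using monomial_in_F[OF that] Suc.IH by blast
  ultimately have "{monomial u es | es. length es \<le> Suc p} \<subseteq> W" by (auto simp: le_Suc_eq)
  then show ?case unfolding F_r_eq by (rule span_minimal[OF _ W(1)])
qed

end

theorem theorem3p15:
  fixes sm :: "complex \<Rightarrow> 'v::ab_group_add \<Rightarrow> 'v"
    and Y :: "'v \<Rightarrow> int \<Rightarrow> 'v \<Rightarrow> 'v"
    and vac om u :: 'v and cc :: complex and n :: nat and w :: int
  assumes "is_VOA sm Y vac om cc"
    and "n \<ge> 1"
    and "u \<in> Vk sm Y om w" and "u \<noteq> 0" and "w \<ge> - int n"
    and "\<forall>a\<in>Vu sm Y vac u. \<forall>b\<in>Vu sm Y vac u. \<forall>m. Y a m b \<in> Vu sm Y vac u"
    and "perm_prop sm Y vac u"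
  shows "gen_n sm Y om n (Vu sm Y vac u) =
         gen_n sm Y om n
           ({mon Y u i vac (2 * n) | i. - int n \<le> int (i 1) * w \<and> int (i 1) * w \<le> int n}
            \<union> {(Y u (-1) ^^ j) vac | j. j \<ge> 1})"
    (is "_ = gen_n sm Y om n ?S")
proof -
  have "vector_space sm" using assms(1) unfolding is_VOA_def by (rule conjunct1)
  then interpret vector_space sm .
  interpret voa_perm sm Y vac om cc u
    by unfold_locales (fact assms(1) assms(7))+
  show ?thesis
  proof (rule gen_n_eqI)
    show "?S \<subseteq> Vu sm Y vac u" using mon_in_Vu upow_in_Vu by blast
    fix W
    assume W: "subspace W" "O_n sm Y om n \<subseteq> W" "?S \<subseteq> W" "\<forall>a\<in>W. \<forall>b\<in>W. star_n sm Y om n a b \<in> W"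
    have "F p \<subseteq> W" for p
    proof (rule F_subset[OF assms(2,3,5) W(1,2)])
      show "star_n sm Y om n a b \<in> W" if "a \<in> W" "b \<in> W" for a b
        using W(4)[rule_format, OF that] .
      show "mon Y u i vac (2 * n) \<in> W" if "- int n \<le> int (i 1) * w" "int (i 1) * w \<le> int n" for i
        by (rule subsetD[OF W(3)]) (use that in blast)
      show "(Y u (-1) ^^ j) vac \<in> W" if "j \<ge> 1" for j
        by (rule subsetD[OF W(3)]) (use that in blast)
    qed
    then have "{monomial u es | es. True} \<subseteq> W" using monomial_in_F[OF order_refl] by blast
    then show "Vu sm Y vac u \<subseteq> W" unfolding Vu_eq by (rule span_minimal[OF _ W(1)])
  qed
qed

end
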